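(* For $\sigma\in\{2431,4213,3241,4132,2413,3142\}$, $$I^{\sigma}(x)=\frac{-1+12x+8x^2+(1-8x)^{3/2}}{32x}.$$
   Context: For a permutation $\pi=\pi_1\cdots\pi_n$ of $[n]$, let $i_\pi$ be the smallest index $i$ with $\{\pi_1,\dots,\pi_i\}=\{1,\dots,i\}$; $\pi$ is indecomposable if $i_\pi=n$. A permutation $\pi$ avoids a pattern $\tau\in\mathfrak S_k$ if no subsequence $\pi_{j_1}\cdots\pi_{j_k}$ ($j_1<\cdots<j_k$) is order-isomorphic to $\tau$. $I^\sigma_n$ denotes the number of $\sigma$-avoiding indecomposable permutations of $[n]$, and $I^\sigma(x)=\sum_{n\ge1}I^\sigma_nx^n$. *)

theory Defs
  imports
    "HOL-Combinatorics.Multiset_Permutations"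
    "HOL-Computational_Algebra.Formal_Power_Series"
    "HOL-Library.Sublist"
begin

text \<open>Permutations of \<open>[n]\<close> are words in one-line notation, i.e. elements of
  \<^term>\<open>permutations_of_set {1..n}\<close>.\<close>

definition order_isomorphic :: "nat list \<Rightarrow> nat list \<Rightarrow> bool" where
  "order_isomorphic u v \<longleftrightarrow> length u = length v \<and>
     (\<forall>i < length u. \<forall>j < length u. u ! i < u ! j \<longleftrightarrow> v ! i < v ! j)"

definition avoids :: "nat list \<Rightarrow> nat list \<Rightarrow> bool" where
  "avoids p t \<longleftrightarrow> \<not> (\<exists>u. subseq u p \<and> order_isomorphic u t)"

text \<open>The index \<open>i\<^sub>\<pi>\<close>; it is meaningful for permutations of \<open>[n]\<close> with \<open>n \<ge> 1\<close>, where
  \<open>i = n\<close> always qualifies.\<close>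

definition first_block_index :: "nat list \<Rightarrow> nat" where
  "first_block_index p = (LEAST i. i \<in> {1..length p} \<and> set (take i p) = {1..i})"

definition indecomposable :: "nat list \<Rightarrow> bool" where
  "indecomposable p \<longleftrightarrow> first_block_index p = length p"

definition num_indecomposable_avoiders :: "nat list \<Rightarrow> nat \<Rightarrow> nat" where
  "num_indecomposable_avoiders s n =
     card {p \<in> permutations_of_set {1..n}. avoids p s \<and> indecomposable p}"

definition indecomposable_gf :: "nat list \<Rightarrow> real fps" where
  "indecomposable_gf s =
     Abs_fps (\<lambda>n. if n = 0 then 0 else of_nat (num_indecomposable_avoiders s n))"

end

theory Submission
  imports Defs
begin

text \<open>
  Grow permutations by inserting a new maximum. For \<open>4132\<close> the admissible sites form a final segment,
  which splits into skew blocks, and only the block lengths matter for the future; for \<open>3142\<close> the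
  admissible sites carry a nested family of intervals, and again only their sizes matter. In both cases the
  generating tree is the same tree of stacks of positive integers. Splitting a walk in this tree at the
  last step that touches the bottom of the stack gives, for the generating function \<open>W(x, y)\<close> of walks
  by length and total size, the equation
  \<open>x y\<^sup>2 W\<^sup>2 - S (y - 1 + x y) W + S (y - 1) = 0\<close> with \<open>S(x) = W(x, 1)\<close>. For each fixed real
  \<open>y \<noteq> 1\<close> it determines the coefficients of \<open>W\<close> recursively, and continuity at \<open>y = 1\<close> then determines
  those of \<open>S\<close>, so it suffices to exhibit one solution.
  The other four patterns follow by reversal, complement and inverse, and \<open>S = 1 + I S\<close> because each of
  the six patterns is indecomposable.
\<close>
section \<open>The quadratic equation\<close>

text \<open>A stack \<open>c\<close> of positive entries has \<open>1 + sum_list c\<close>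
  successors, and in both models a permutation with stack \<open>c\<close> has exactly that many
  admissible sites, one per successor. Choosing a site amounts to choosing a level of the stack. The
  entries below that level stay; the entry at that level is merged with everything above it and the
  new letter, or it is cut down and gets a fresh \<open>1\<close> on top. The one remaining site
  pushes \<open>1\<close> onto the whole stack. The weight \<open>y\<close> is a real parameter and
  not a second formal variable because at \<open>y = 1\<close> the quadratic equation reads
  \<open>0 = 0\<close>. It gives no direct information on \<open>S\<close>, which is reached only as
  a limit from neighbouring values of \<open>y\<close>.\<close>

unbundle fps_syntax

text \<open>On the left, \<open>F 1 * (F y - 1)\<close> is \<open>F y - 1\<close> plus
  \<open>(F 1 - 1) * (F y - 1)\<close>. Both factors of that product lack a constant term, so its
  coefficient \<open>n\<close> uses only indices strictly between \<open>0\<close> and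
  \<open>n\<close>. On the right, \<open>fps_X\<close> lowers the index. Hence for \<open>y\<close>
  other than \<open>1\<close>, \<open>F y $ n\<close> depends on lower coefficients only, and not on
  the still unknown \<open>F 1 $ n\<close>.\<close>

lemma quadratic_solution_unique:
  fixes F G :: "real \<Rightarrow> real fps"
  assumes F: "\<And>y. 0 < y \<Longrightarrow> fps_const (y - 1) * F 1 * (F y - 1) =
      fps_X * (fps_const (y^2) * F y ^ 2 - fps_const y * F 1 * F y)"
  assumes G: "\<And>y. 0 < y \<Longrightarrow> fps_const (y - 1) * G 1 * (G y - 1) =
      fps_X * (fps_const (y^2) * G y ^ 2 - fps_const y * G 1 * G y)"
  assumes F0: "F 1 $ 0 = 1" and G0: "G 1 $ 0 = 1"
  assumes contF: "\<And>n. isCont (\<lambda>y. F y $ n) 1" and contG: "\<And>n. isCont (\<lambda>y. G y $ n) 1"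
  assumes y: "0 < y"
  shows "F y = G y"
proof -
  have zero: "H y $ 0 = 1" if "0 < y" "H 1 $ 0 = 1"
    and H: "fps_const (y - 1) * H 1 * (H y - 1) =
      fps_X * (fps_const (y^2) * H y ^ 2 - fps_const y * H 1 * H y)" for H :: "real \<Rightarrow> real fps" and y
    using arg_cong[OF H, of "\<lambda>f. f $ 0"] that(1,2) by (cases "y = 1") auto
  have coeff: "(y - 1) * H y $ n =
      (fps_const (y^2) * H y ^ 2 - fps_const y * H 1 * H y) $ (n - 1) - (y - 1) * ((H 1 - 1) * (H y - 1)) $ n"
    if "0 < n" and H: "fps_const (y - 1) * H 1 * (H y - 1) =
      fps_X * (fps_const (y^2) * H y ^ 2 - fps_const y * H 1 * H y)" 
    for H :: "real \<Rightarrow> real fps" and y n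
  proof -
    let ?r = "fps_const (y^2) * H y ^ 2 - fps_const y * H 1 * H y"
    have "fps_const (y - 1) * (H y - 1) = fps_X * ?r - fps_const (y - 1) * ((H 1 - 1) * (H y - 1))"
      unfolding H[symmetric] by (simp add: algebra_simps)
    from arg_cong[OF this, of "\<lambda>f. f $ n"] \<open>0 < n\<close> show ?thesis
      by (simp only: fps_sub_nth fps_X_mult_nth fps_mult_left_const_nth fps_one_nth) simp
  qed
  have mult_cong: "(a * b) $ n = (a' * b') $ n"
    if "\<And>i. i \<le> n \<Longrightarrow> a $ i = a' $ i" "\<And>i. i \<le> n \<Longrightarrow> b $ i = b' $ i"
    for a b a' b' :: "real fps" and n
    unfolding fps_mult_nth using that by (intro sum.cong) auto
  have "F y $ n = G y $ n" if "0 < y" for n y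
    using that
  \<comment> \<open>\<open>y\<close> must vary: the recursion for \<open>F y\<close> calls lower
    coefficients of \<open>F 1\<close>.\<close>
  proof (induction n arbitrary: y rule: less_induct)
    case (less n)
    have 1: "F y $ n = G y $ n" if y: "0 < y" "y \<noteq> 1" for y
    proof (cases "n = 0")
      case True
      then show ?thesis using zero[of y F, OF y(1) F0 F[OF y(1)]] zero[of y G, OF y(1) G0 G[OF y(1)]] by simp
    next
      case False
      have IH: "F z $ i = G z $ i" if "0 < z" "i \<le> n - 1" for i z using less(1) that False by auto
      have "((F 1 - 1) * (F y - 1)) $ n = ((G 1 - 1) * (G y - 1)) $ n"
        unfolding fps_mult_nth
      proof (rule sum.cong[OF refl])
        fix i assume "i \<in> {0..n}"
        consider "i = 0" | "i = n" | "0 < i" "i < n" using \<open>i \<in> {0..n}\<close> by fastforce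
        then show "(F 1 - 1) $ i * (F y - 1) $ (n - i) = (G 1 - 1) $ i * (G y - 1) $ (n - i)"
          using zero[of y F, OF y(1) F0 F[OF y(1)]] zero[of y G, OF y(1) G0 G[OF y(1)]] F0 G0
            IH[of 1 i] IH[of y "n - i"] y by cases auto
      qed
      moreover have "(fps_const (y^2) * F y ^ 2 - fps_const y * F 1 * F y) $ (n - 1)
          = (fps_const (y^2) * G y ^ 2 - fps_const y * G 1 * G y) $ (n - 1)"
        using IH y mult_cong[of "n - 1" "F y" "G y" "F y" "G y"] mult_cong[of "n - 1" "F 1" "G 1" "F y" "G y"]
        by (simp add: power2_eq_square mult.assoc)
      ultimately have "(y - 1) * F y $ n = (y - 1) * G y $ n"
        using coeff[of n y F, OF _ F[OF y(1)]] coeff[of n y G, OF _ G[OF y(1)]] False by simp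
      then show ?thesis using y by simp
    qed
    show ?case
    proof (cases "y = 1")
      case True
      have "((\<lambda>y. F y $ n) \<longlongrightarrow> F 1 $ n) (at 1)" "((\<lambda>y. G y $ n) \<longlongrightarrow> G 1 $ n) (at 1)"
        using contF contG by (auto simp: isCont_def)
      moreover have "\<forall>\<^sub>F y in at 1. F y $ n = G y $ n"
        using eventually_at_in_open'[of "{0<..}" "1::real"] eventually_at_filter
        by (auto simp: eventually_at_topological intro!: exI[of _ "{0<..}"] 1)
      ultimately have "((\<lambda>y. G y $ n) \<longlongrightarrow> F 1 $ n) (at 1)" using tendsto_cong by fast
      with \<open>((\<lambda>y. G y $ n) \<longlongrightarrow> G 1 $ n) (at 1)\<close> True show ?thesis
        using tendsto_unique[of "at (1::real)"] by (metis at_neq_bot)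
    qed (use 1 less in auto)
  qed
  then show ?thesis using y by (simp add: fps_eq_iff)
qed

section \<open>Square roots of power series and the explicit solution\<close>

definition sqrt_fps :: "real fps \<Rightarrow> real fps" where
  "sqrt_fps f = fps_binomial (1/2) oo (f - 1)"

lemma sqrt_fps_nth_0 [simp]: "sqrt_fps f $ 0 = 1"
  by (simp add: sqrt_fps_def)

text \<open>With \<open>f $ 0 = 1\<close> the series \<open>f - 1\<close> may be substituted for
  \<open>fps_X\<close>, which carries the square root of \<open>1 + fps_X\<close> over to
  \<open>f\<close>.\<close>

lemma sqrt_fps_square:
  assumes "f $ 0 = 1"
  shows "sqrt_fps f * sqrt_fps f = f"
proof -
  have "fps_binomial (1/2::real) * fps_binomial (1/2) = 1 + fps_X"
    by (simp add: fps_binomial_add_mult[symmetric] fps_binomial_1)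
  then have "sqrt_fps f * sqrt_fps f = (1 + fps_X) oo (f - 1)"
    unfolding sqrt_fps_def using assms by (subst fps_compose_mult_distrib[symmetric]) auto
  then show ?thesis by (simp add: fps_compose_add_distrib assms)
qed

lemma sqrt_fps_unique:
  assumes "g * g = f" and "g $ 0 = 1"
  shows "sqrt_fps f = g"
proof -
  have "f $ 0 = 1" using assms by auto
  then have "(sqrt_fps f - g) * (sqrt_fps f + g) = 0"
    using sqrt_fps_square[of f] assms(1) by (simp add: algebra_simps)
  moreover have "sqrt_fps f + g \<noteq> 0" using assms(2) by (auto simp: fps_eq_iff intro!: exI[of _ 0])
  ultimately show ?thesis by simp
qed

text \<open>With \<open>Z = (3 + (1 - 8x)\<^sup>1\<^sup>/\<^sup>2) / 4\<close>, the discriminant of the quadratic equation in \<open>W\<close> has the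
  double root \<open>y = 1 / Z\<close>; this is where the formulas for \<open>S\<close> and \<open>W\<close> come from.\<close>

definition root_fps :: "real fps" where "root_fps = sqrt_fps (1 - 8 * fps_X)"

definition Z_fps :: "real fps" where "Z_fps = fps_const (3/4) + fps_const (1/4) * root_fps"

definition S_fps :: "real fps" where "S_fps = (2 * Z_fps - 1) * inverse Z_fps ^ 3"

lemma root_fps_square: "root_fps * root_fps = 1 - 8 * fps_X"
  unfolding root_fps_def by (rule sqrt_fps_square) simp

lemma four_Z: "4 * Z_fps = 3 + root_fps"
proof -
  have "4 * Z_fps = fps_const 4 * Z_fps" by (simp add: numeral_fps_const)
  also have "\<dots> = fps_const 3 + root_fps" by (simp add: Z_fps_def distrib_left mult.assoc[symmetric])
  finally show ?thesis by (simp add: numeral_fps_const)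
qed

lemma Z_nth_0 [simp]: "Z_fps $ 0 = 1" by (simp add: Z_fps_def root_fps_def)

lemma Z_root: "(2 * Z_fps - 1) * (1 - Z_fps) = fps_X"
proof -
  have "8 * ((2 * Z_fps - 1) * (1 - Z_fps)) = (4 * Z_fps - 2) * (4 - 4 * Z_fps)" by (simp add: algebra_simps)
  also have "\<dots> = 1 - root_fps * root_fps" unfolding four_Z by (simp add: algebra_simps)
  also have "\<dots> = 8 * fps_X" by (simp add: root_fps_square)
  finally show ?thesis by simp
qed

lemma S_Z: "S_fps * Z_fps ^ 3 = 2 * Z_fps - 1"
proof -
  have "inverse Z_fps * Z_fps = 1" by (simp add: inverse_mult_eq_1)
  then show ?thesis unfolding S_fps_def by (simp add: mult.assoc power_mult_distrib[symmetric])
qed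

lemma numeral_fps_nth_0: "(numeral k :: 'a::comm_ring_1 fps) $ 0 = numeral k"
  by (simp add: numeral_fps_const)

lemma S_nth_0 [simp]: "S_fps $ 0 = 1" by (simp add: S_fps_def numeral_fps_nth_0 fps_power_zeroth)

text \<open>The numerator of the quadratic formula, divided by \<open>S\<close>. Write
  \<open>x\<close> for \<open>fps_X\<close>. The discriminant divided by \<open>S^2\<close> is
  \<open>((1 + x) y - 1)^2 - 4 x y^2 (y - 1) / S\<close>, which is to equal
  \<open>(1 - Z y)^2 (1 - 4 Z (1 - Z) y)\<close>. Comparing coefficients of \<open>y\<close> and
  \<open>y^3\<close> gives \<open>x = (2 Z - 1) (1 - Z)\<close> and \<open>S Z^3 = 2 Z - 1\<close>.
  The sign of the root is the one that makes the constant term vanish, so that division by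
  \<open>x\<close> stays within power series.\<close>

definition N_fps :: "real \<Rightarrow> real fps" where
  "N_fps y = (1 + fps_X) * fps_const y - 1
     + (1 - Z_fps * fps_const y) * sqrt_fps (1 - 4 * Z_fps * (1 - Z_fps) * fps_const y)"

definition W_fps :: "real \<Rightarrow> real fps" where
  "W_fps y = fps_const (1 / (2 * y^2)) * S_fps * fps_shift 1 (N_fps y)"

lemma W_N:
  assumes "y \<noteq> 0"
  shows "2 * fps_const (y^2) * fps_X * W_fps y = S_fps * N_fps y"
proof -
  have "N_fps y $ 0 = 0" by (simp add: N_fps_def numeral_fps_nth_0)
  then have *: "fps_X * fps_shift 1 (N_fps y) = N_fps y"
    by (intro fps_ext) (auto simp: fps_X_mult_nth)
  have "2 * fps_const (y^2) * fps_X * W_fps y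
     = (2 * fps_const (y^2) * fps_const (1 / (2*y^2))) * S_fps * (fps_X * fps_shift 1 (N_fps y))"
    unfolding W_fps_def by (simp only: ac_simps)
  also have "2 * fps_const (y^2) * fps_const (1 / (2*y^2)) = 1"
    using assms by (simp add: numeral_fps_const)
  finally show ?thesis unfolding * mult_1_left .
qed

text \<open>At \<open>y = 1\<close> the radicand is the square of \<open>2 * Z_fps - 1\<close>,
  whose constant term \<open>1\<close> identifies it as the chosen root.\<close>

lemma W_1: "W_fps 1 = S_fps"
proof -
  have "sqrt_fps (1 - 4 * Z_fps * (1 - Z_fps)) = 2 * Z_fps - 1"
    by (rule sqrt_fps_unique) (simp_all add: algebra_simps numeral_fps_nth_0)
  then have "N_fps 1 = fps_X + (1 - Z_fps) * (2 * Z_fps - 1)"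
    by (simp add: N_fps_def)
  then have "N_fps 1 = fps_X + (2 * Z_fps - 1) * (1 - Z_fps)" by (simp only: mult.commute)
  then have "N_fps 1 = 2 * fps_X" by (simp add: Z_root)
  with W_N[of 1] have "2 * fps_X * W_fps 1 = 2 * fps_X * S_fps" by (simp add: ac_simps)
  then show ?thesis by simp
qed

lemma W_quadratic:
  assumes "y > 0"
  shows "fps_const (y - 1) * W_fps 1 * (W_fps y - 1) =
      fps_X * (fps_const (y^2) * W_fps y ^ 2 - fps_const y * W_fps 1 * W_fps y)"
proof -
  define c where "c = fps_const y"
  define s where "s = sqrt_fps (1 - 4 * Z_fps * (1 - Z_fps) * c)"
  define N where "N = N_fps y"
  define W where "W = W_fps y"
  have c: "fps_const (y^2) = c^2" "fps_const (y - 1) = c - 1" "c \<noteq> 0"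
    using assms by (auto simp: c_def fps_const_power fps_const_sub[symmetric] simp del: fps_const_sub)
  have s2: "s * s = 1 - 4 * Z_fps * (1 - Z_fps) * c"
    unfolding s_def by (rule sqrt_fps_square) (simp add: numeral_fps_nth_0)
  have N: "N = (1 + fps_X) * c - 1 + (1 - Z_fps * c) * s"
    by (simp add: N_def N_fps_def c_def s_def)
  have WN: "2 * c^2 * fps_X * W = S_fps * N" using W_N[of y] assms by (simp add: c N_def W_def)
  \<comment> \<open>Completing the square in \<open>N\<close> isolates the factored
    discriminant.\<close>
  have "(N * N - 2 * ((1 + fps_X) * c - 1) * N) = (1 - Z_fps * c)^2 * (s * s) - ((1 + fps_X) * c - 1)^2"
    unfolding N by (simp add: algebra_simps power2_eq_square)
  also have "\<dots> = -4 * (1 - Z_fps) * Z_fps^3 * c^2 * (c - 1)"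
    unfolding s2 Z_root[symmetric] by (simp add: algebra_simps power2_eq_square power3_eq_cube)
  finally have "S_fps * (N * N - 2 * ((1 + fps_X) * c - 1) * N) = -4 * (1 - Z_fps) * (S_fps * Z_fps^3) * c^2 * (c - 1)"
    by simp
  also have "\<dots> = - 4 * fps_X * c^2 * (c - 1)" unfolding S_Z Z_root[symmetric] by (simp add: algebra_simps)
  \<comment> \<open>Two factors \<open>S_fps\<close> let every \<open>N\<close> occur as
    \<open>S_fps * N\<close>, which is \<open>2 * c^2 * fps_X * W\<close>; then
    \<open>4 * fps_X * c^2\<close> cancels.\<close>
  finally have "S_fps * (S_fps * (N * N - 2 * ((1 + fps_X) * c - 1) * N)) = S_fps * (- 4 * fps_X * c^2 * (c - 1))"
    by (rule arg_cong)
  then have "(S_fps * N) * (S_fps * N) - 2 * S_fps * ((1 + fps_X) * c - 1) * (S_fps * N)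
      + 4 * fps_X * S_fps * c^2 * (c - 1) = 0"
    by (simp add: algebra_simps) 
  then have "4 * fps_X * c^2 * (fps_X * c^2 * W^2 - S_fps * (c - 1 + fps_X * c) * W + S_fps * (c - 1)) = 0"
    unfolding WN[symmetric] by (simp add: algebra_simps power2_eq_square)
  then have "fps_X * c^2 * W^2 - S_fps * (c - 1 + fps_X * c) * W + S_fps * (c - 1) = 0"
    using c by simp
  then show ?thesis unfolding W_1 c W_def[symmetric] c_def[symmetric]
    by (simp add: algebra_simps)
qed

text \<open>Each coefficient of the square root is a polynomial in \<open>y\<close>, since only
  finitely many powers contribute to it. The only denominator is \<open>2 * y^2\<close>.\<close>

lemma W_continuous: "isCont (\<lambda>y. W_fps y $ n) 1"
proof -
  have sq: "isCont (\<lambda>y. sqrt_fps (1 - 4 * Z_fps * (1 - Z_fps) * fps_const y) $ m) 1" for m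
  proof -
    have "sqrt_fps (1 - 4 * Z_fps * (1 - Z_fps) * fps_const y) $ m =
      (\<Sum>i = 0..m. ((1/2) gchoose i) * (y ^ i * ((- 4 * Z_fps * (1 - Z_fps)) ^ i $ m)))" for y
    proof -
      have "1 - 4 * Z_fps * (1 - Z_fps) * fps_const y - 1 = fps_const y * (- 4 * Z_fps * (1 - Z_fps))" by simp
      then show ?thesis unfolding sqrt_fps_def fps_compose_nth
        by (simp only: power_mult_distrib fps_const_power fps_mult_left_const_nth fps_binomial_nth)
    qed
    then show ?thesis by (simp only:) (intro continuous_intros)
  qed
  have "isCont (\<lambda>y. N_fps y $ m) 1" for m
    unfolding N_fps_def fps_add_nth fps_sub_nth fps_mult_nth[of "1 - _"] fps_mult_right_const_nth
    by (intro continuous_intros sq)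
  then show ?thesis unfolding W_fps_def fps_mult_nth[of "fps_const _ * _"] fps_mult_left_const_nth fps_shift_nth
    by (intro continuous_intros) auto
qed

lemma S_fps_closed_form:
  assumes "S_fps = 1 + I * S_fps"
  shows "I = (- 1 + 12 * fps_X + 8 * fps_X ^ 2 + (fps_binomial (3 / 2) oo (- 8 * fps_X))) / (32 * fps_X)"
proof -
  let ?r = root_fps
  have "fps_binomial (3/2::real) = fps_binomial (1/2) * fps_binomial (1/2) * fps_binomial (1/2)"
    by (simp add: fps_binomial_add_mult[symmetric])
  then have r3: "fps_binomial (3/2::real) oo (- 8 * fps_X) = ?r * ?r * ?r"
    unfolding root_fps_def sqrt_fps_def
    by (simp add: fps_compose_mult_distrib numeral_fps_nth_0)
  have "(2 * Z_fps - 1) * (1 - I) = Z_fps^3"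
    using assms S_Z by (metis (no_types, lifting) add_diff_cancel_right' left_diff_distrib mult.assoc mult.commute mult_1)
  \<comment> \<open>Here \<open>4 * Z_fps - 2\<close> is \<open>1 + root_fps\<close>. The extra
    factor \<open>4 - 4 * Z_fps\<close>, that is \<open>1 - root_fps\<close>, completes it to
    \<open>1 - root_fps^2 = 8 * fps_X\<close>, the origin of the denominator in the closed
    form.\<close>
  then have "(4 - 4 * Z_fps) * 8 * (4 * Z_fps - 2) * (4 - 4*I) = (4 - 4 * Z_fps) * (4 * Z_fps)^3"
  proof -
    have "(4 - 4 * Z_fps) * 8 * (4 * Z_fps - 2) * (4 - 4*I) = 64 * (4 - 4 * Z_fps) * ((2 * Z_fps - 1) * (1 - I))"
      by (simp add: algebra_simps)
    also have "\<dots> = (4 - 4 * Z_fps) * (4 * Z_fps)^3"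
      unfolding \<open>_ = Z_fps^3\<close> by (simp add: power_mult_distrib)
    finally show ?thesis .
  qed
  then have "8 * (1 - ?r * ?r) * (4 - 4 * I) = (1 - ?r) * (3 + ?r)^3"
    unfolding four_Z by (simp add: algebra_simps)
  also have "\<dots> = 27 - 18 * (?r * ?r) - 8 * (?r * ?r * ?r) - (?r * ?r) * (?r * ?r)"
    by (simp add: algebra_simps power3_eq_cube)
  finally have "8 * (32 * fps_X * I) = 8 * (-1 + 12 * fps_X + 8 * fps_X^2 + ?r * ?r * ?r)"
    unfolding root_fps_square by (simp add: algebra_simps power2_eq_square)
  then have "-1 + 12 * fps_X + 8 * fps_X^2 + ?r * ?r * ?r = (32 * fps_X) * I"
    by (simp only: mult_left_cancel[of "8 :: real fps"] zero_neq_numeral[symmetric] not_False_eq_True)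
  then show ?thesis unfolding r3 by simp
qed

section \<open>Stack walks\<close>

text \<open>Stacks are listed bottom first.\<close>

primrec succs :: "nat list \<Rightarrow> nat list list" where
  "succs [] = [[1]]"
| "succs (b # d) = map ((#) b) (succs d) @ [1 + b + sum_list d] # map (\<lambda>b'. [b', 1]) [1..<b]"

primrec walk :: "nat \<Rightarrow> nat list list" where
  "walk 0 = [[]]"
| "walk (Suc n) = concat (map succs (walk n))"

definition walk_sum :: "nat \<Rightarrow> (nat list \<Rightarrow> real) \<Rightarrow> real" where
  "walk_sum n f = (\<Sum>c\<leftarrow>walk n. f c)"

text \<open>Ranges over the cuts of the bottom entry without the \<open>1\<close> put on top, which
  is instead counted as the first step of the walk above.\<close>

definition drops :: "nat list \<Rightarrow> (nat \<Rightarrow> real) \<Rightarrow> real" where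
  "drops c g = (case c of [] \<Rightarrow> 0 | b # d \<Rightarrow> \<Sum>b'\<leftarrow>[1..<b]. g b')"

lemma drops_simps [simp]: "drops [] g = 0" "drops (b # d) g = (\<Sum>b'\<leftarrow>[1..<b]. g b')"
  by (simp_all add: drops_def)

lemma walk_sum_0 [simp]: "walk_sum 0 f = f []"
  by (simp add: walk_sum_def)

lemma walk_sum_Suc: "walk_sum (Suc n) f = walk_sum n (\<lambda>c. \<Sum>c'\<leftarrow>succs c. f c')"
proof -
  have "(\<Sum>c'\<leftarrow>concat (map succs cs). f c') = (\<Sum>c\<leftarrow>cs. \<Sum>c'\<leftarrow>succs c. f c')" for cs
    by (induction cs) auto
  then show ?thesis by (simp add: walk_sum_def)
qed

lemma walk_sum_cong: "(\<And>c. c \<in> set (walk n) \<Longrightarrow> f c = g c) \<Longrightarrow> walk_sum n f = walk_sum n g"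
  unfolding walk_sum_def by (metis (mono_tags, lifting) map_eq_conv)

lemma walk_sum_add: "walk_sum n (\<lambda>c. f c + g c) = walk_sum n f + walk_sum n g"
  by (simp add: walk_sum_def sum_list_addf)

lemma walk_sum_mult: "walk_sum n (\<lambda>c. k * f c) = k * walk_sum n f"
  by (simp add: walk_sum_def sum_list_const_mult)

lemma walk_sum_mult_right: "walk_sum n (\<lambda>c. f c * k) = walk_sum n f * k"
  by (simp add: walk_sum_def sum_list_mult_const)

lemma walk_sum_const: "walk_sum n (\<lambda>_. k) = k * real (length (walk n))"
  by (simp add: walk_sum_def sum_list_triv)

lemma drops_mult_right: "drops c (\<lambda>b. g b * k) = drops c g * k"
  by (cases c) (simp_all add: sum_list_mult_const del: upt_Suc)

lemma succs_pos: "c' \<in> set (succs c) \<Longrightarrow> (\<forall>b\<in>set c. 0 < b) \<Longrightarrow> c' \<noteq> [] \<and> (\<forall>b\<in>set c'. 0 < b)"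
  by (induction c arbitrary: c') auto

lemma walk_pos: "c \<in> set (walk n) \<Longrightarrow> (\<forall>b\<in>set c. 0 < b) \<and> (0 < n \<longrightarrow> c \<noteq> [])"
  by (induction n arbitrary: c) (use succs_pos in fastforce)+

text \<open>Split a nonempty walk at the last step that touches the bottom entry: that step either
  merges the whole stack into one entry, or cuts the bottom entry down and puts \<open>1\<close> on top of it,
  which is also the first step of a walk from the empty stack.\<close>

lemma walk_sum_bottom:
  "walk_sum (Suc n) f = (\<Sum>i\<le>n. walk_sum i (\<lambda>c. walk_sum (n - i) (\<lambda>d. f ((1 + sum_list c) # d))))
     + (\<Sum>i\<le>n. walk_sum i (\<lambda>c. drops c (\<lambda>b. walk_sum (Suc n - i) (\<lambda>d. f (b # d)))))"
proof (induction n arbitrary: f)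
  case 0
  show ?case by (simp add: walk_sum_Suc)
next
  case (Suc n)
  \<comment> \<open>The successors that keep the bottom entry. The other two kinds supply the new
    summands \<open>i = Suc n\<close>.\<close>
  define g where "g c = (case c of [] \<Rightarrow> 0 | a # d \<Rightarrow> \<Sum>d'\<leftarrow>succs d. f (a # d'))" for c
  have "walk_sum (Suc (Suc n)) f = walk_sum (Suc n) (\<lambda>c. \<Sum>c'\<leftarrow>succs c. f c')" by (rule walk_sum_Suc)
  also have "\<dots> = walk_sum (Suc n) (\<lambda>c. g c + (f [1 + sum_list c] + drops c (\<lambda>b. f [b, 1])))"
  proof (rule walk_sum_cong)
    fix c assume "c \<in> set (walk (Suc n))"
    then have "c \<noteq> []" using walk_pos by blast
    then obtain a d where "c = a # d" by (auto simp: neq_Nil_conv)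
    then show "(\<Sum>c'\<leftarrow>succs c. f c') = g c + (f [1 + sum_list c] + drops c (\<lambda>b. f [b, 1]))"
      by (simp add: g_def comp_def add.assoc del: upt_Suc)
  qed
  also have "\<dots> = walk_sum (Suc n) g + (walk_sum (Suc n) (\<lambda>c. f [1 + sum_list c])
      + walk_sum (Suc n) (\<lambda>c. drops c (\<lambda>b. f [b, 1])))"
    by (simp only: walk_sum_add)
  also have "walk_sum (Suc n) g =
     (\<Sum>i\<le>n. walk_sum i (\<lambda>c. walk_sum (Suc n - i) (\<lambda>d. f ((1 + sum_list c) # d))))
     + (\<Sum>i\<le>n. walk_sum i (\<lambda>c. drops c (\<lambda>b. walk_sum (Suc (Suc n) - i) (\<lambda>d. f (b # d)))))"
    unfolding Suc.IH by (intro arg_cong2[of _ _ _ _ "(+)"] sum.cong)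
       (simp_all add: g_def Suc_diff_le walk_sum_Suc[symmetric])
  finally show ?case by (simp add: walk_sum_Suc[of 0])
qed

section \<open>The generating function of walks and its quadratic equation\<close>

definition walk_gf :: "real \<Rightarrow> real fps" where
  "walk_gf y = Abs_fps (\<lambda>n. walk_sum n (\<lambda>c. y ^ sum_list c))"

lemma walk_gf_1_nth: "walk_gf 1 $ n = real (length (walk n))"
  by (simp add: walk_gf_def walk_sum_def sum_list_triv)

text \<open>\<open>walk_sum_bottom\<close> is used twice, with \<open>x\<close> for
  \<open>fps_X\<close>. Weighting by total size gives \<open>W = 1 + x y W^2 + D (W - 1)\<close>.
  Weighting by the bottom entry alone leaves the upper walk unweighted and gives
  \<open>Q = x y W S + D (S - 1)\<close>. Summing the geometric series in a cut gives
  \<open>(y - 1) D = Q - y (S - 1)\<close>. The three relations eliminate \<open>Q\<close> and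
  \<open>D\<close> without a division by \<open>y - S\<close>.\<close>

lemma walk_gf_quadratic:
  "fps_const (y - 1) * walk_gf 1 * (walk_gf y - 1) =
     fps_X * (fps_const (y^2) * walk_gf y ^ 2 - fps_const y * walk_gf 1 * walk_gf y)"
proof -
  define W where "W = walk_gf y"
  define S where "S = walk_gf 1"
  define D where "D = Abs_fps (\<lambda>n. walk_sum n (\<lambda>c. drops c (\<lambda>b. y ^ b)))"
  define bot :: "nat list \<Rightarrow> real" where "bot c = (case c of [] \<Rightarrow> 0 | b # d \<Rightarrow> y ^ b)" for c
  define Q where "Q = Abs_fps (\<lambda>n. walk_sum n bot)"
  have W0: "W $ 0 = 1" and S0: "S $ 0 = 1" by (simp_all add: W_def S_def walk_gf_def)
  \<comment> \<open>The walk above a cut has at least one step, hence \<open>V - 1\<close>.\<close>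
  have conv: "(\<Sum>i\<le>n. D $ i * V $ (Suc n - i)) = (D * (V - 1)) $ Suc n" if "V $ 0 = 1" for V n
    using that by (simp add: fps_mult_nth atLeast0AtMost Suc_diff_le)
  have "W $ Suc n = (1 + fps_const y * fps_X * W * W + D * (W - 1)) $ Suc n" for n
  proof -
    have "W $ Suc n = (\<Sum>i\<le>n. y * W $ i * W $ (n - i)) + (\<Sum>i\<le>n. D $ i * W $ (Suc n - i))"
      unfolding W_def D_def walk_gf_def fps_nth_Abs_fps walk_sum_bottom
      by (simp add: power_add walk_sum_mult walk_sum_mult_right drops_mult_right mult.assoc)
    then show ?thesis using conv[of W, OF W0, of n]
      by (simp add: mult.assoc fps_mult_nth[of W] sum_distrib_left atLeast0AtMost)
  qed
  then have eqW: "W = 1 + fps_const y * fps_X * W * W + D * (W - 1)"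
    by (intro fps_ext, case_tac n) (simp_all add: W0)
  have "Q $ Suc n = (fps_const y * fps_X * W * S + D * (S - 1)) $ Suc n" for n
  proof -
    have "Q $ Suc n = (\<Sum>i\<le>n. y * W $ i * S $ (n - i)) + (\<Sum>i\<le>n. D $ i * S $ (Suc n - i))"
      unfolding W_def S_def D_def Q_def walk_gf_def fps_nth_Abs_fps walk_sum_bottom
      by (simp add: bot_def walk_sum_mult walk_sum_mult_right drops_mult_right mult.assoc walk_sum_const)
    then show ?thesis using conv[of S, OF S0, of n]
      by (simp add: mult.assoc fps_mult_nth[of W] sum_distrib_left atLeast0AtMost)
  qed
  moreover have "Q $ 0 = 0" by (simp add: Q_def bot_def)
  ultimately have eqQ: "Q = fps_const y * fps_X * W * S + D * (S - 1)"
    by (intro fps_ext, case_tac n) (simp_all add: S0)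
  have eqD: "fps_const (y - 1) * D = Q - fps_const y * (S - 1)"
  proof (rule fps_ext)
    fix n
    have geo: "(y - 1) * (\<Sum>b'\<leftarrow>[1..<b]. y ^ b') = y ^ b - y" if "0 < b" for b
      using that
    proof (induction b)
      case (Suc b)
      then show ?case by (cases "b = 0") (simp_all add: algebra_simps)
    qed simp
    show "(fps_const (y - 1) * D) $ n = (Q - fps_const y * (S - 1)) $ n"
    proof (cases "n = 0")
      case False
      have "(y - 1) * walk_sum n (\<lambda>c. drops c (\<lambda>b. y ^ b)) = walk_sum n (\<lambda>c. bot c + (- y) * 1)"
        unfolding walk_sum_mult[symmetric]
      proof (rule walk_sum_cong)
        fix c assume "c \<in> set (walk n)"
        then have "c \<noteq> []" "\<forall>b\<in>set c. 0 < b" using walk_pos False by blast+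
        then obtain a d where "c = a # d" "0 < a" by (auto simp: neq_Nil_conv)
        then show "(y - 1) * drops c (\<lambda>b. y ^ b) = bot c + (- y) * 1"
          using geo[of a] by (simp add: bot_def)
      qed
      also have "\<dots> = walk_sum n bot + (- y) * walk_sum n (\<lambda>_. 1)" by (simp only: walk_sum_add walk_sum_mult)
      finally show ?thesis using False by (simp add: D_def Q_def S_def walk_gf_def)
    qed (simp add: D_def Q_def S_def walk_gf_def bot_def)
  qed
  define c where "c = fps_const y"
  have c1: "fps_const (y - 1) = c - 1" "fps_const (y^2) = c^2"
    by (simp_all add: c_def fps_const_power fps_const_sub[symmetric] del: fps_const_sub)
  have kernel: "(c - S) * D = c * (fps_X * W * S - S + 1)"
    using eqD unfolding eqQ c1 c_def[symmetric] by (simp add: algebra_simps)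
  have "(c - S) * (W - 1 - c * fps_X * W * W) = (c - S) * D * (W - 1)"
    using eqW unfolding c_def by (metis (no_types, lifting) add_diff_cancel_left' diff_diff_eq mult.assoc)
  also have "\<dots> = c * (fps_X * W * S - S + 1) * (W - 1)" unfolding kernel ..
  finally show ?thesis unfolding c1 W_def[symmetric] S_def[symmetric] c_def[symmetric]
    by (simp add: algebra_simps power2_eq_square)
qed

lemma walk_gf_continuous: "isCont (\<lambda>y. walk_gf y $ n) 1"
proof -
  have "isCont (\<lambda>y. \<Sum>c\<leftarrow>cs. y ^ sum_list c) (1::real)" for cs :: "nat list list"
    by (induction cs) (auto intro!: continuous_intros)
  then show ?thesis by (simp add: walk_gf_def walk_sum_def)
qed

lemma walk_gf_1: "walk_gf 1 = S_fps"
  using quadratic_solution_unique[of walk_gf W_fps, OF walk_gf_quadratic W_quadratic _ _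
      walk_gf_continuous W_continuous, of 1]
  by (simp add: W_1 walk_gf_1_nth)

section \<open>Growing permutations by inserting the maximum\<close>

definition ins :: "nat \<Rightarrow> nat \<Rightarrow> nat list \<Rightarrow> nat list" where
  "ins m i p = take i p @ m # drop i p"

lemma ins_append_left: "i \<le> length xs \<Longrightarrow> ins m i (xs @ ys) = ins m i xs @ ys"
  by (simp add: ins_def)

lemma ins_append_right: "ins m (length xs + i) (xs @ ys) = xs @ ins m i ys"
  by (simp add: ins_def)

lemma set_ins: "set (ins m i p) = insert m (set p)"
proof -
  have "set (take i p) \<union> set (drop i p) = set p" by (simp flip: set_append)
  then show ?thesis by (simp add: ins_def)
qed

text \<open>The only occurrence of \<open>m\<close> marks the site, and deleting it recovers the
  parent.\<close>

lemma ins_inject: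
  assumes "ins m i p = ins m j q" "m \<notin> set p" "m \<notin> set q" "i \<le> length p" "j \<le> length q"
  shows "i = j \<and> p = q"
proof -
  have *: "m \<notin> set (take i p)" "m \<notin> set (take j q)" using assms(2,3) by (meson in_set_takeD)+
  have "takeWhile (\<lambda>x. x \<noteq> m) (ins m i p) = take i p" "takeWhile (\<lambda>x. x \<noteq> m) (ins m j q) = take j q"
    using * unfolding ins_def by (subst takeWhile_append2; force)+
  then have t: "take i p = take j q" using assms(1) by simp
  then have "i = j" using assms(4,5) by (metis length_take min.absorb2)
  moreover from t assms(1) have "drop i p = drop j q" by (simp add: ins_def)
  ultimately show ?thesis using t by (metis append_take_drop_id)
qed

lemma permutations_of_set_Suc:
  "permutations_of_set {1..Suc n} = {ins (Suc n) i p |i p. p \<in> permutations_of_set {1..n} \<and> i \<le> n}"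
proof (intro equalityI subsetI)
  fix q assume q: "q \<in> permutations_of_set {1..Suc n}"
  then have "Suc n \<in> set q" by (auto simp: permutations_of_set_def)
  then obtain L R where LR: "q = L @ Suc n # R" by (meson split_list)
  have "distinct q" "set q = {1..Suc n}" using q by (auto simp: permutations_of_set_def)
  then have d: "distinct (L @ R)" and "insert (Suc n) (set (L @ R)) = {1..Suc n}" "Suc n \<notin> set (L @ R)"
    by (auto simp: LR)
  then have "set (L @ R) = {1..Suc n} - {Suc n}" by blast
  also have "\<dots> = {1..n}" by auto
  finally have s: "set (L @ R) = {1..n}" .
  have "length L \<le> n" using distinct_card[OF d] s by simp
  moreover have "q = ins (Suc n) (length L) (L @ R)" by (simp add: LR ins_def)
  ultimately show "q \<in> {ins (Suc n) i p |i p. p \<in> permutations_of_set {1..n} \<and> i \<le> n}"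
    using d s unfolding permutations_of_set_def by blast
next
  fix q assume "q \<in> {ins (Suc n) i p |i p. p \<in> permutations_of_set {1..n} \<and> i \<le> n}"
  then obtain i p where p: "q = ins (Suc n) i p" "set p = {1..n}" "distinct p" "i \<le> n"
    by (auto simp: permutations_of_set_def)
  then have "set q = {1..Suc n}" by (auto simp: set_ins)
  moreover have "distinct (take i p @ drop i p)" using p by simp
  then have "distinct q" using p set_take_subset[of i p] set_drop_subset[of i p]
    unfolding ins_def by (auto simp del: append_take_drop_id)
  ultimately show "q \<in> permutations_of_set {1..Suc n}" by (simp add: permutations_of_set_def)
qed

text \<open>The relation \<open>R\<close> makes the tree of \<open>Q\<close>-permutations, grown by inserting a new maximum,
  isomorphic to the tree generated by \<^const>\<open>succs\<close>.\<close>

lemma card_by_simulation: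
  assumes "Q []" and "R [] []"
    and hereditary: "\<And>m i p. Q (ins m i p) \<Longrightarrow> Q p"
    and step: "\<And>n p c. p \<in> permutations_of_set {1..n} \<Longrightarrow> Q p \<Longrightarrow> R p c \<Longrightarrow>
      \<exists>sites. distinct sites \<and> set sites = {i. i \<le> n \<and> Q (ins (Suc n) i p)} \<and>
        list_all2 (\<lambda>i. R (ins (Suc n) i p)) sites (succs c)"
  shows "card {p \<in> permutations_of_set {1..n}. Q p} = length (walk n)"
proof -
  \<comment> \<open>Lists are paired rather than sets because different permutations may carry the
    same stack, which \<open>walk n\<close> then lists repeatedly.\<close>
  have grow: "\<exists>qs. distinct qs \<and> list_all2 R qs (concat (map succs cs)) \<and>
      set qs = {ins (Suc n) i p |i p. p \<in> set ps \<and> i \<le> n \<and> Q (ins (Suc n) i p)}"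
    if "list_all2 R ps cs" "distinct ps" "set ps \<subseteq> {p \<in> permutations_of_set {1..n}. Q p}" for ps cs n
    using that
  proof (induction rule: list_all2_induct)
    case Nil
    show ?case by auto
  next
    case (Cons p ps c cs)
    then obtain qs where qs: "distinct qs" "list_all2 R qs (concat (map succs cs))"
      "set qs = {ins (Suc n) i p |i p. p \<in> set ps \<and> i \<le> n \<and> Q (ins (Suc n) i p)}" by auto
    obtain sites where sites: "distinct sites" "set sites = {i. i \<le> n \<and> Q (ins (Suc n) i p)}"
        "list_all2 (\<lambda>i. R (ins (Suc n) i p)) sites (succs c)"
      using step[of p n c] Cons by auto
    let ?new = "map (\<lambda>i. ins (Suc n) i p) sites"
    have perm: "Suc n \<notin> set q \<and> length q = n" if "q \<in> set (p # ps)" for q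
    proof -
      have "q \<in> permutations_of_set {1..n}" using that Cons.prems(2) by blast
      then show ?thesis using distinct_card[of q] by (auto simp: permutations_of_set_def)
    qed
    have "distinct ?new"
      using sites(1,2) ins_inject perm[of p] by (auto simp: distinct_map inj_on_def)
    moreover have "set ?new \<inter> set qs = {}"
    proof (rule ccontr)
      assume "\<not> ?thesis"
      then obtain i j q where q: "i \<le> n" "j \<le> n" "q \<in> set ps" "ins (Suc n) i p = ins (Suc n) j q"
        using qs(3) sites(2) by auto
      then have "p = q" using ins_inject[OF q(4)] perm[of p] perm[of q] by simp
      then show False using q Cons.prems by simp
    qed
    moreover have "list_all2 R (?new @ qs) (succs c @ concat (map succs cs))"
      using qs(2) sites(3) by (intro list_all2_appendI) (simp_all add: list_all2_map1)
    moreover have "set (?new @ qs) = {ins (Suc n) i q |i q. q \<in> set (p # ps) \<and> i \<le> n \<and> Q (ins (Suc n) i q)}"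
      using qs(3) sites(2) by auto
    ultimately show ?case using qs(1) by (intro exI[of _ "?new @ qs"]) simp
  qed
  have "\<exists>ps. distinct ps \<and> list_all2 R ps (walk n) \<and> set ps = {p \<in> permutations_of_set {1..n}. Q p}"
  proof (induction n)
    case 0
    show ?case using assms(1,2) by (intro exI[of _ "[[]]"]) (auto simp: permutations_of_set_def)
  next
    case (Suc n)
    then obtain ps where ps: "distinct ps" "list_all2 R ps (walk n)" "set ps = {p \<in> permutations_of_set {1..n}. Q p}"
      by blast
    obtain qs where "distinct qs" "list_all2 R qs (walk (Suc n))"
      "set qs = {ins (Suc n) i p |i p. p \<in> set ps \<and> i \<le> n \<and> Q (ins (Suc n) i p)}"
      using grow[of ps "walk n" n] ps by auto
    moreover have "\<dots> = {p \<in> permutations_of_set {1..Suc n}. Q p}"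
      unfolding permutations_of_set_Suc ps(3) using hereditary by blast
    ultimately show ?case by auto
  qed
  then show ?thesis using distinct_card list_all2_lengthD by metis
qed

section \<open>Avoiding 4132\<close>

lemma ex_Cons_append_iff:
  "(\<exists>u v. a # xs = u @ v \<and> P u v) \<longleftrightarrow> P [] (a # xs) \<or> (\<exists>u v. xs = u @ v \<and> P (a # u) v)"
  by (auto simp: Cons_eq_append_conv)

lemma subseq_pair_append:
  "subseq [a, b] (xs @ ys) \<longleftrightarrow> subseq [a, b] xs \<or> a \<in> set xs \<and> b \<in> set ys \<or> subseq [a, b] ys"
  by (auto simp: subseq_append_iff ex_Cons_append_iff subseq_singleton_left)

lemma subseq_triple_append:
  "subseq [a, b, c] (xs @ ys) \<longleftrightarrow> subseq [a, b, c] xs \<or> subseq [a, b] xs \<and> c \<in> set ys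
     \<or> a \<in> set xs \<and> subseq [b, c] ys \<or> subseq [a, b, c] ys"
  by (auto simp: subseq_append_iff ex_Cons_append_iff subseq_singleton_left)

lemma subseq_set: "subseq xs ys \<Longrightarrow> set xs \<subseteq> set ys"
  by (auto dest: list_emb_set)

lemma subseq_delete:
  assumes "subseq u (xs @ m # ys)" "m \<notin> set u"
  shows "subseq u (xs @ ys)"
proof -
  obtain u1 u2 where u: "u = u1 @ u2" "subseq u1 xs" "subseq u2 (m # ys)"
    using assms(1) by (auto simp: subseq_append_iff)
  have "subseq u2 ys" using u(3) assms(2) by (cases u2) (auto simp: u(1) split: if_splits)
  then show ?thesis using u by (auto intro: list_emb_append_mono)
qed

definition has_132 :: "nat list \<Rightarrow> bool" where
  "has_132 xs \<longleftrightarrow> (\<exists>a b c. subseq [a, b, c] xs \<and> a < c \<and> c < b)"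

definition has_4132 :: "nat list \<Rightarrow> bool" where
  "has_4132 xs \<longleftrightarrow> (\<exists>a b c d. subseq [d, a, b, c] xs \<and> a < c \<and> c < b \<and> b < d)"

lemma has_132_mono: "has_132 xs \<Longrightarrow> subseq xs ys \<Longrightarrow> has_132 ys"
  unfolding has_132_def by (meson subseq_order.trans)

lemma has_4132_mono: "has_4132 xs \<Longrightarrow> subseq xs ys \<Longrightarrow> has_4132 ys"
  unfolding has_4132_def by (meson subseq_order.trans)

lemma subseq_insert: "subseq (xs @ ys) (xs @ m # ys)"
  by (simp add: subseq_append' list_emb_Cons)

text \<open>If an occurrence straddled the cut, its \<open>1\<close> would lie in \<open>xs\<close>
  and its \<open>2\<close> in \<open>ys\<close>, so the \<open>2\<close> would be the smaller of
  them.\<close>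

lemma has_132_skew_append:
  assumes "\<forall>x\<in>set xs. \<forall>y\<in>set ys. y < x"
  shows "has_132 (xs @ ys) \<longleftrightarrow> has_132 xs \<or> has_132 ys"
proof
  assume "has_132 (xs @ ys)"
  then obtain a b c where *: "subseq [a, b, c] (xs @ ys)" "a < c" "c < b"
    by (auto simp: has_132_def)
  have "\<not> (a \<in> set xs \<and> c \<in> set ys)" using assms *(2) by (meson order.asym)
  then have "subseq [a, b, c] xs \<or> subseq [a, b, c] ys"
    using *(1) unfolding subseq_triple_append by (meson subseq_set list.set_intros subsetD)
  then show "has_132 xs \<or> has_132 ys" using * unfolding has_132_def by blast
next
  assume "has_132 xs \<or> has_132 ys"
  then show "has_132 (xs @ ys)"
    using has_132_mono[of xs "xs @ ys"] has_132_mono[of ys "xs @ ys"] by (auto intro: subseq_drop_many subseq_rev_drop_many)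
qed

text \<open>A last letter could only play the \<open>2\<close>, and a maximum has no
  \<open>3\<close> above it.\<close>

lemma has_132_snoc_max:
  assumes "\<forall>x\<in>set xs. x \<le> m"
  shows "has_132 (xs @ [m]) \<longleftrightarrow> has_132 xs"
proof
  assume "has_132 (xs @ [m])"
  then obtain a b c where *: "subseq [a, b, c] (xs @ [m])" "a < c" "c < b"
    by (auto simp: has_132_def)
  have "\<not> (subseq [a, b] xs \<and> c = m)" using assms *(3) subseq_set[of "[a, b]" xs] by (auto simp: not_le[symmetric])
  then have "subseq [a, b, c] xs" using *(1) unfolding subseq_triple_append by (auto split: if_splits)
  then show "has_132 xs" using * unfolding has_132_def by blast
qed (auto intro: has_132_mono)

text \<open>A new maximum can only play the \<open>4\<close>, with a 132 to its right.\<close>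

lemma has_4132_insert_max:
  assumes "\<forall>x\<in>set (xs @ ys). x < m"
  shows "has_4132 (xs @ m # ys) \<longleftrightarrow> has_4132 (xs @ ys) \<or> has_132 ys"
proof
  assume "has_4132 (xs @ m # ys)"
  then obtain a b c d where *: "subseq [d, a, b, c] (xs @ m # ys)" "a < c" "c < b" "b < d"
    by (auto simp: has_4132_def)
  have "d \<in> set (xs @ m # ys)" using subseq_set[OF *(1)] by simp
  then have "d \<le> m" using assms by (auto intro: less_imp_le)
  show "has_4132 (xs @ ys) \<or> has_132 ys"
  proof (cases "d = m")
    case True
    from *(1) obtain u v where uv: "[d, a, b, c] = u @ v" "subseq u xs" "subseq v (m # ys)"
      by (auto simp: subseq_append_iff)
    have "u = []" using uv(1,2) assms True subseq_set[OF uv(2)] by (cases u) auto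
    then have "v = [m, a, b, c]" using uv(1) True by simp
    then have "subseq [a, b, c] ys" using uv(3) by simp
    then show ?thesis using * by (auto simp: has_132_def)
  next
    case False
    then have "m \<notin> set [d, a, b, c]" using * \<open>d \<le> m\<close> by auto
    then have "subseq [d, a, b, c] (xs @ ys)" using *(1) subseq_delete by metis
    then show ?thesis using * by (auto simp: has_4132_def)
  qed
next
  assume "has_4132 (xs @ ys) \<or> has_132 ys"
  then show "has_4132 (xs @ m # ys)"
  proof
    assume "has_4132 (xs @ ys)"
    then show ?thesis using subseq_insert by (rule has_4132_mono)
  next
    assume "has_132 ys"
    then obtain a b c where *: "subseq [a, b, c] ys" "a < c" "c < b" by (auto simp: has_132_def)
    then have "subseq [m, a, b, c] (xs @ m # ys)" by (auto intro: subseq_drop_many)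
    moreover have "b < m" using subseq_set[OF *(1)] assms by auto
    ultimately show ?thesis using * by (auto simp: has_4132_def)
  qed
qed

text \<open>Blocks are listed from right to left, so that the list matches a stack with its bottom first.\<close>

primrec skew_blocks :: "nat list list \<Rightarrow> bool" where
  "skew_blocks [] \<longleftrightarrow> True"
| "skew_blocks (B # Bs) \<longleftrightarrow> B \<noteq> [] \<and> \<not> has_132 B \<and> (\<forall>x\<in>set (butlast B). x < last B) \<and>
     (\<forall>x\<in>set (concat Bs). \<forall>y\<in>set B. y < x) \<and> skew_blocks Bs"

lemma skew_blocks_no_132: "skew_blocks Bs \<Longrightarrow> \<not> has_132 (concat (rev Bs))"
proof (induction Bs)
  case Nil
  show ?case by (simp add: has_132_def)
next
  case (Cons B Bs)
  then show ?case using has_132_skew_append[of "concat (rev Bs)" B] by auto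
qed

text \<open>The condition on \<open>last u\<close> makes the suffix the longest one free of 132, so
  for a 4132-avoiding \<open>p\<close> its gaps, both ends included, are the admissible sites. The
  blocks end at the right-to-left maxima of the suffix: in a 132-free word the letters before the
  maximum exceed those after it.\<close>

definition suffix_state :: "nat list \<Rightarrow> nat list \<Rightarrow> bool" where
  "suffix_state p c \<longleftrightarrow> (\<exists>u Bs. p = u @ concat (rev Bs) \<and> skew_blocks Bs \<and> map length Bs = c \<and>
     (u \<noteq> [] \<longrightarrow> has_132 (last u # concat (rev Bs))))"

text \<open>\<open>B\<close> is the rightmost and lowest block, the bottom of the stack. A site left
  of \<open>B\<close>, or at its left edge, acts on the blocks above and leaves \<open>B\<close>
  alone. At the right end \<open>m\<close> closes the whole word into one block. A site strictly
  inside \<open>B\<close> creates a 132, so the suffix shrinks to \<open>m\<close> and the remaining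
  letters of \<open>B\<close>.\<close>

lemma skew_blocks_insert_max:
  assumes "skew_blocks Bs" "\<forall>x\<in>set (concat Bs). x < m"
  shows "\<exists>sites. distinct sites \<and> set sites = {..length (concat Bs)} \<and>
    list_all2 (\<lambda>i. suffix_state (ins m i (concat (rev Bs)))) sites (succs (map length Bs))"
  using assms
proof (induction Bs)
  case Nil
  have "suffix_state [m] [1]" unfolding suffix_state_def
    by (intro exI[of _ "[]"] exI[of _ "[[m]]"]) (auto simp: has_132_def)
  then show ?case by (intro exI[of _ "[0]"]) (auto simp: ins_def)
next
  case (Cons B Bs)
  let ?w = "concat (rev Bs)"
  obtain sites where sites: "distinct sites" "set sites = {..length (concat Bs)}"
    "list_all2 (\<lambda>i. suffix_state (ins m i ?w)) sites (succs (map length Bs))"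
    using Cons by auto
  have len: "length (concat Bs) = length ?w" by (simp add: length_concat rev_map[symmetric] sum_list_rev)
  have above: "suffix_state (ins m i (concat (rev (B # Bs)))) (length B # c)"
    if st: "suffix_state (ins m i ?w) c" and i: "i \<le> length ?w" for i c
  proof -
    obtain u Cs where u: "ins m i ?w = u @ concat (rev Cs)" "skew_blocks Cs" "map length Cs = c"
      "u \<noteq> [] \<longrightarrow> has_132 (last u # concat (rev Cs))" using st unfolding suffix_state_def by blast
    have "set (concat Cs) \<subseteq> insert m (set (concat Bs))"
      using arg_cong[OF u(1), of set] by (auto simp: set_ins)
    then have "\<forall>x\<in>set (concat Cs). \<forall>y\<in>set B. y < x" using Cons.prems by fastforce
    then have "skew_blocks (B # Cs)" using u(2) Cons.prems(1) by simp
    moreover have "u \<noteq> [] \<longrightarrow> has_132 (last u # concat (rev (B # Cs)))"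
      using u(4) by (auto intro: has_132_mono)
    moreover have "ins m i (concat (rev (B # Bs))) = u @ concat (rev (B # Cs))"
      using u(1) i by (simp add: ins_append_left)
    ultimately show ?thesis unfolding suffix_state_def using u(3) by (metis list.simps(9))
  qed
  have at_end: "suffix_state (ins m (length ?w + length B) (concat (rev (B # Bs)))) [1 + length B + sum_list (map length Bs)]"
  proof -
    have "\<not> has_132 (?w @ B)" using skew_blocks_no_132[OF Cons.prems(1)] by simp
    then have "\<not> has_132 (?w @ B @ [m])"
      using has_132_snoc_max[of "?w @ B" m] Cons.prems(2) by (auto intro: less_imp_le)
    then have "skew_blocks [?w @ B @ [m]]" using Cons.prems(2) by (auto simp: butlast_append)
    then show ?thesis unfolding suffix_state_def
      by (intro exI[of _ "[]"] exI[of _ "[?w @ B @ [m]]"])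
         (simp add: ins_def length_concat rev_map[symmetric] sum_list_rev)
  qed
  \<comment> \<open>\<open>b\<close> letters of \<open>B\<close> stay to the right of
    \<open>m\<close>. The value \<open>b = length B\<close> is excluded: that site is the left edge
    of \<open>B\<close>, already covered by \<open>above\<close>.\<close>
  have inside: "suffix_state (ins m (length ?w + (length B - b)) (concat (rev (B # Bs)))) [b, 1]"
    if b: "b \<in> {1..<length B}" for b
  proof -
    define X Y where "X = take (length B - b) B" and "Y = drop (length B - b) B"
    then have B: "B = X @ Y" "X \<noteq> []" "Y \<noteq> []" "length X = length B - b" "length Y = b" using b by auto
    have less: "x < last Y" if "x \<in> set X \<union> set (butlast Y)" for x
      using that Cons.prems(1) B(3) by (auto simp: B(1) butlast_append)
    have "\<not> has_132 Y" using Cons.prems(1) has_132_mono[of Y B] by (auto simp: B(1) subseq_drop_many)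
    moreover have "\<not> has_132 [m]" by (simp add: has_132_def)
    moreover have below: "\<forall>y\<in>set Y. y < m" using Cons.prems(2) by (simp add: B(1))
    ultimately have "skew_blocks [Y, [m]]" using less B(3) by simp
    \<comment> \<open>The \<open>2\<close> is \<open>last Y\<close>, the maximum of
      \<open>B\<close>, which exceeds every letter of \<open>X\<close>.\<close>
    moreover have "has_132 (last X # m # Y)"
    proof -
      have "last X < last Y" using less B(2) by simp
      moreover have "last Y < m" using below B(3) by simp
      moreover have "subseq [last X, m, last Y] (last X # m # Y)"
        using B(3) by (simp add: subseq_singleton_left)
      ultimately show ?thesis unfolding has_132_def by blast
    qed
    moreover have "ins m (length ?w + (length B - b)) (concat (rev (B # Bs))) = (?w @ X) @ concat (rev [Y, [m]])"
      unfolding B(4)[symmetric] by (simp add: ins_append_right) (simp add: ins_def B(1))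
    ultimately show ?thesis unfolding suffix_state_def using B(2,5)
      by (intro exI[of _ "?w @ X"] exI[of _ "[Y, [m]]"]) simp
  qed
  define new where "new = map (\<lambda>b. length ?w + (length B - b)) [1..<length B]"
  define e where "e = length ?w + length B"
  have e: "length ?w < e" using Cons.prems by (simp add: e_def)
  have set_new: "set new = {length ?w<..<e}"
  proof (intro equalityI subsetI)
    fix x assume "x \<in> {length ?w<..<e}"
    then show "x \<in> set new" unfolding new_def e_def set_map
      by (intro image_eqI[where x = "length ?w + length B - x"]) auto
  qed (auto simp: new_def e_def)
  have "distinct new" by (auto simp: new_def distinct_map inj_on_def)
  then have "distinct (sites @ e # new)"
    using sites(1) e unfolding distinct_append distinct.simps sites(2) len set_new list.set by auto
  moreover have "set (sites @ e # new) = {..length (concat (B # Bs))}"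
  proof -
    have "length (concat (B # Bs)) = e" unfolding e_def len[symmetric] by simp
    then show ?thesis using e unfolding set_append list.set sites(2) len set_new by auto
  qed
  moreover have "list_all2 (\<lambda>i. suffix_state (ins m i (concat (rev (B # Bs))))) (sites @ e # new) (succs (map length (B # Bs)))"
  proof -
    have "list_all2 (\<lambda>i. suffix_state (ins m i (concat (rev (B # Bs))))) sites (map ((#) (length B)) (succs (map length Bs)))"
      unfolding list_all2_map2 using sites(3)
    proof (rule list.rel_mono_strong)
      fix i c assume "i \<in> set sites" "suffix_state (ins m i ?w) c"
      then show "suffix_state (ins m i (concat (rev (B # Bs)))) (length B # c)"
        using above by (simp only: sites(2) len atMost_iff)
    qed
    moreover have "list_all2 (\<lambda>i. suffix_state (ins m i (concat (rev (B # Bs))))) new (map (\<lambda>b. [b, 1]) [1..<length B])"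
      unfolding new_def list_all2_map1 list_all2_map2 list_all2_same set_upt using inside by blast
    ultimately show ?thesis using at_end unfolding list.map(2) succs.simps e_def
      by (intro list_all2_appendI list_all2_Cons[THEN iffD2] conjI)
  qed
  ultimately show ?case by blast
qed

theorem card_no_4132: "card {p \<in> permutations_of_set {1..n}. \<not> has_4132 p} = length (walk n)"
proof (rule card_by_simulation[where R = suffix_state])
  show "\<not> has_4132 []" by (simp add: has_4132_def)
  show "suffix_state [] []" by (auto simp: suffix_state_def)
  show "\<not> has_4132 p" if "\<not> has_4132 (ins m i p)" for m i p
    using that has_4132_mono[OF _ subseq_insert[of "take i p" "drop i p" m]] by (auto simp: ins_def)
next
  fix n p c
  assume p: "p \<in> permutations_of_set {1..n}" and no: "\<not> has_4132 p" and st: "suffix_state p c"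
  obtain u Bs where u: "p = u @ concat (rev Bs)" "skew_blocks Bs" "map length Bs = c"
     "u \<noteq> [] \<longrightarrow> has_132 (last u # concat (rev Bs))" using st unfolding suffix_state_def by blast
  let ?w = "concat (rev Bs)"
  have len: "length (concat Bs) = length ?w" by (simp add: length_concat rev_map[symmetric] sum_list_rev)
  have sp: "set p = {1..n}" and lp: "length p = n" using p distinct_card[of p] by (auto simp: permutations_of_set_def)
  have "set (concat Bs) \<subseteq> {1..n}" unfolding sp[symmetric] u(1) by auto
  then have "\<forall>x\<in>set (concat Bs). x < Suc n" by auto
  then obtain sites where sites: "distinct sites" "set sites = {..length (concat Bs)}"
    "list_all2 (\<lambda>i. suffix_state (ins (Suc n) i ?w)) sites (succs c)"
    using skew_blocks_insert_max[OF u(2), of "Suc n"] u(3) by auto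
  have act: "has_4132 (ins (Suc n) i p) \<longleftrightarrow> has_132 (drop i p)" for i
  proof -
    have "\<forall>x\<in>set (take i p @ drop i p). x < Suc n" using sp by simp
    from has_4132_insert_max[OF this] no show ?thesis by (simp add: ins_def)
  qed
  \<comment> \<open>Maximality of the suffix: to the right of any earlier site lie
    \<open>last u\<close> and the entire suffix.\<close>
  have "has_132 (drop i p) \<longleftrightarrow> i < length u" for i
  proof (cases "i < length u")
    case True
    then have "u \<noteq> []" "last (drop i u) = last u" "drop i u \<noteq> []" by auto
    then have "drop i p = butlast (drop i u) @ last u # ?w"
      using True append_butlast_last_id[of "drop i u"] by (simp add: u(1))
    then have "subseq (last u # ?w) (drop i p)" by (simp add: subseq_drop_many)
    then show ?thesis using True u(4) \<open>u \<noteq> []\<close> has_132_mono by blast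
  next
    case False
    then have "subseq (drop i p) ?w" by (auto simp: u(1) intro: suffix_imp_subseq suffix_drop)
    then show ?thesis using False skew_blocks_no_132[OF u(2)] has_132_mono by blast
  qed
  moreover have "(+) k ` {..m} = {i. i \<le> k + m \<and> \<not> i < k}" for k m :: nat
  proof (intro equalityI subsetI)
    fix x assume "x \<in> {i. i \<le> k + m \<and> \<not> i < k}"
    then show "x \<in> (+) k ` {..m}" by (intro image_eqI[where x = "x - k"]) auto
  qed auto
  ultimately have "set (map ((+) (length u)) sites) = {i. i \<le> n \<and> \<not> has_4132 (ins (Suc n) i p)}"
    unfolding act set_map sites(2) len using lp u(1) by simp
  moreover have "suffix_state (ins (Suc n) (length u + i) p) d"
    if st': "suffix_state (ins (Suc n) i ?w) d" for i d
  proof -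
    obtain v Cs where v: "ins (Suc n) i ?w = v @ concat (rev Cs)" "skew_blocks Cs" "map length Cs = d"
      "v \<noteq> [] \<longrightarrow> has_132 (last v # concat (rev Cs))" using st' unfolding suffix_state_def by blast
    have "has_132 (last (u @ v) # concat (rev Cs))" if "u @ v \<noteq> []"
    proof (cases "v = []")
      case True
      \<comment> \<open>The new suffix contains the old one as a subsequence, so
        \<open>last u\<close> still starts a word with a 132.\<close>
      then have "subseq ?w (concat (rev Cs))" using v(1) 
          subseq_insert[of "take i ?w" "drop i ?w" "Suc n"] by (simp add: ins_def)
      then show ?thesis using True that u(4) has_132_mono[of "last u # ?w"] by auto
    qed (use v(4) in simp)
    then show ?thesis unfolding suffix_state_def using v(1-3)
      by (intro exI[of _ "u @ v"] exI[of _ Cs]) (auto simp: u(1) ins_append_right)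
  qed
  then have "list_all2 (\<lambda>i. suffix_state (ins (Suc n) i p)) (map ((+) (length u)) sites) (succs c)"
    unfolding list_all2_map1 by (intro list_all2_mono[OF sites(3)])
  ultimately show "\<exists>sites. distinct sites \<and> set sites = {i. i \<le> n \<and> \<not> has_4132 (ins (Suc n) i p)} \<and>
      list_all2 (\<lambda>i. suffix_state (ins (Suc n) i p)) sites (succs c)"
    using sites(1) by (intro exI[of _ "map ((+) (length u)) sites"]) (auto simp: distinct_map)
qed

section \<open>Avoiding 3142\<close>

definition has_3142 :: "nat list \<Rightarrow> bool" where
  "has_3142 xs \<longleftrightarrow> (\<exists>a b c d. subseq [c, a, d, b] xs \<and> a < b \<and> b < c \<and> c < d)"

text \<open>What is excluded is a 31 left of the site with a matching 2 on its right, which a new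
  maximum at \<open>t\<close> would complete to 3142.\<close>

definition active :: "nat list \<Rightarrow> nat \<Rightarrow> bool" where
  "active p t \<longleftrightarrow> \<not> (\<exists>a b c. subseq [c, a] (take t p) \<and> b \<in> set (drop t p) \<and> a < b \<and> b < c)"

text \<open>The condition for an active site \<open>t\<close> to survive a new maximum at
  \<open>s <= t\<close>: the new letter can play the \<open>3\<close>, so no letter between
  \<open>s\<close> and \<open>t\<close> may be a \<open>1\<close> for a later
  \<open>2\<close>.\<close>

definition above_rest :: "nat list \<Rightarrow> nat \<Rightarrow> nat \<Rightarrow> bool" where
  "above_rest p s t \<longleftrightarrow> (\<forall>x\<in>set (drop s (take t p)). \<forall>y\<in>set (drop t p). y < x)"

lemma has_3142_mono: "has_3142 xs \<Longrightarrow> subseq xs ys \<Longrightarrow> has_3142 ys"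
  unfolding has_3142_def by (meson subseq_order.trans)

lemma has_3142_ins_max:
  assumes "\<forall>x\<in>set p. x < m" and no: "\<not> has_3142 p"
  shows "has_3142 (ins m t p) \<longleftrightarrow> \<not> active p t"
proof
  let ?xs = "take t p" and ?ys = "drop t p"
  assume "has_3142 (ins m t p)"
  then obtain a b c d where *: "subseq [c, a, d, b] (?xs @ m # ?ys)" "a < b" "b < c" "c < d"
    by (auto simp: has_3142_def ins_def)
  have m: "\<forall>x\<in>set (?xs @ ?ys). x < m" using assms by simp
  have "d \<in> set (?xs @ m # ?ys)" using subseq_set[OF *(1)] by simp
  then have "d = m \<or> d \<in> set (?xs @ ?ys)" unfolding set_append list.set by blast
  then have "d \<le> m" using m less_imp_le by blast
  have "d = m"
  proof (rule ccontr)
    assume "d \<noteq> m"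
    then have "m \<notin> set [c, a, d, b]" using * \<open>d \<le> m\<close> by auto
    then have "subseq [c, a, d, b] p" using subseq_delete[OF *(1)] by simp
    then show False using no *(2-4) unfolding has_3142_def by blast
  qed
  have "m \<notin> set ?xs" "m \<notin> set ?ys" using m unfolding set_append by blast+
  then have "\<not> subseq [m, b] ?xs" "\<not> subseq [m, b] ?ys" "\<not> subseq [a, m, b] ?ys"
      "\<not> subseq [c, a, m, b] ?ys" "\<not> subseq [c, a, m] ?xs" "\<not> subseq [c, a, m, b] ?xs"
    using subseq_set by fastforce+
  then have "subseq [c, a] ?xs \<and> b \<in> set ?ys"
    using *(1,2,3,4) \<open>d = m\<close>
    by (auto simp: subseq_append_iff ex_Cons_append_iff subseq_singleton_left)
  then show "\<not> active p t" using * by (auto simp: active_def)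
next
  assume "\<not> active p t"
  then obtain a b c where *: "subseq [c, a] (take t p)" "b \<in> set (drop t p)" "a < b" "b < c"
    by (auto simp: active_def)
  have "subseq ([c, a] @ [m, b]) (take t p @ m # drop t p)"
    using *(1,2) by (intro list_emb_append_mono) (auto simp: subseq_singleton_left)
  moreover have "c \<in> set p" using subseq_set[OF *(1)] in_set_takeD by auto
  then have "c < m" using assms by blast
  ultimately show "has_3142 (ins m t p)" using *(3,4) by (auto simp: has_3142_def ins_def)
qed

section \<open>How one insertion changes \<open>active\<close> and \<open>above_rest\<close>\<close>

context
  fixes p :: "nat list" and m s :: nat
  assumes p: "distinct p" "\<forall>x\<in>set p. x < m" and s: "s \<le> length p"
begin

lemma take_ins_le: "t \<le> s \<Longrightarrow> take t (ins m s p) = take t p"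
  using s by (simp add: ins_def)

lemma drop_ins_le: "t \<le> s \<Longrightarrow> set (drop t (ins m s p)) = insert m (set (drop t p))"
proof -
  assume t: "t \<le> s"
  have "drop t p = drop t (take s p) @ drop s p"
    using t s by (metis append_take_drop_id drop_append length_take min.absorb2 diff_is_0_eq drop0)
  then show ?thesis using t s by (simp add: ins_def)
qed

lemma take_ins_Suc: "s \<le> t \<Longrightarrow> take (Suc t) (ins m s p) = take s p @ m # drop s (take t p)"
  using s by (simp add: ins_def Suc_diff_le drop_take)

lemma take_split: "s \<le> t \<Longrightarrow> take t p = take s p @ drop s (take t p)"
  using s by (metis append_take_drop_id min.absorb1 take_take)

lemma drop_ins_Suc: "s \<le> t \<Longrightarrow> drop (Suc t) (ins m s p) = drop t p"
  using s by (simp add: ins_def Suc_diff_le)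

text \<open>Right of the site, \<open>m\<close> could only play the \<open>2\<close>, but no
  \<open>3\<close> exceeds it.\<close>

lemma active_ins_le: "t \<le> s \<Longrightarrow> active (ins m s p) t \<longleftrightarrow> active p t"
proof -
  assume t: "t \<le> s"
  have "\<not> m < c" if "subseq [c, a] (take t p)" for a c
    using subseq_set[OF that] in_set_takeD p(2) by (metis list.set_intros(1) not_less_iff_gr_or_eq subsetD)
  then show ?thesis unfolding active_def take_ins_le[OF t] drop_ins_le[OF t] by blast
qed

text \<open>A 31 left of the site either omits \<open>m\<close>, and was present before, or has
  \<open>m\<close> as its \<open>3\<close> and its \<open>1\<close> between \<open>s\<close> and
  \<open>t\<close>. As the \<open>1\<close>, \<open>m\<close> would need a larger
  \<open>2\<close>.\<close>

lemma active_ins_Suc: "s \<le> t \<Longrightarrow> active (ins m s p) (Suc t) \<longleftrightarrow> active p t \<and> above_rest p s t"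
proof -
  assume t: "s \<le> t"
  let ?x = "take s p" and ?y = "drop s (take t p)" and ?z = "drop t p"
  have small: "x < m" if "x \<in> set ?x \<union> set ?y \<union> set ?z" for x
    using that p(2) by (auto dest!: in_set_takeD in_set_dropD)
  have "distinct (take t p @ ?z)" using p(1) by simp
  then have disj: "set ?y \<inter> set ?z = {}"
    by (metis distinct_append take_split[OF t] append_assoc disjoint_iff in_set_dropD)
  have "(\<exists>a b c. subseq [c, a] (?x @ m # ?y) \<and> b \<in> set ?z \<and> a < b \<and> b < c) \<longleftrightarrow>
     (\<exists>a b c. subseq [c, a] (?x @ ?y) \<and> b \<in> set ?z \<and> a < b \<and> b < c) \<or> (\<exists>a\<in>set ?y. \<exists>b\<in>set ?z. a < b)"
    (is "?l \<longleftrightarrow> ?r \<or> ?e")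
  proof
    assume ?l
    then obtain a b c where *: "subseq [c, a] (?x @ m # ?y)" "b \<in> set ?z" "a < b" "b < c" by blast
    have "b < m" using small *(2) by blast
    then have "a \<noteq> m" using *(3) by simp
    show "?r \<or> ?e"
    proof (cases "c = m")
      case True
      have "c \<notin> set ?x" using True small by blast
      then have "\<not> subseq [c, a] ?x" using subseq_set by fastforce
      then have "a \<in> set ?y" using *(1) \<open>c \<notin> set ?x\<close> True small[of m] subseq_set[of "[c, a]" ?y]
        by (auto simp: subseq_pair_append subseq_singleton_left)
      then show ?thesis using * by blast
    next
      case False
      then have "subseq [c, a] (?x @ ?y)" using subseq_delete[OF *(1)] \<open>a \<noteq> m\<close> by simp
      then show ?thesis using * by blast
    qed
  next
    assume "?r \<or> ?e"
    then show ?l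
    proof
      assume ?r
      then show ?l using subseq_insert[of ?x ?y m] by (meson subseq_order.trans)
    next
      assume ?e
      then obtain a b where ab: "a \<in> set ?y" "b \<in> set ?z" "a < b" by blast
      then have "subseq [m, a] (?x @ m # ?y)" by (auto intro!: subseq_drop_many simp: subseq_singleton_left)
      then show ?l using ab small by blast
    qed
  qed
  moreover have "\<not> ?e \<longleftrightarrow> above_rest p s t"
  proof -
    have "\<not> a < b \<longleftrightarrow> b < a" if "a \<in> set ?y" "b \<in> set ?z" for a b
      using that disj by (metis disjoint_iff linorder_cases order.asym)
    then show ?thesis unfolding above_rest_def by blast
  qed
  ultimately show ?thesis
    unfolding active_def take_ins_Suc[OF t] drop_ins_Suc[OF t] take_split[OF t, symmetric] by blast
qed

text \<open>This lemma and the next two place \<open>m\<close> right of the segment from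
  \<open>r\<close> to \<open>t\<close>, inside it, and left of it. On the right it exceeds the
  segment; inside it exceeds all that follows; on the left it is invisible.\<close>

lemma above_rest_ins_le: "r < t \<Longrightarrow> t \<le> s \<Longrightarrow> \<not> above_rest (ins m s p) r t"
proof -
  assume t: "r < t" "t \<le> s"
  have "drop r (take t p) \<noteq> []" using t s by simp
  then obtain x where x: "x \<in> set (drop r (take t p))" by (meson ex_in_conv set_empty)
  then have "x < m" using p(2) by (meson in_set_takeD in_set_dropD)
  then show ?thesis unfolding above_rest_def take_ins_le[OF t(2)] drop_ins_le[OF t(2)]
    using x by (meson insertI1 order.asym)
qed

lemma above_rest_ins_Suc: "r \<le> s \<Longrightarrow> s \<le> t \<Longrightarrow> above_rest (ins m s p) r (Suc t) \<longleftrightarrow> above_rest p r t"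
proof -
  assume t: "r \<le> s" "s \<le> t"
  have "set (drop r (take (Suc t) (ins m s p))) = insert m (set (drop r (take t p)))"
    unfolding take_ins_Suc[OF t(2)] by (subst take_split[OF t(2)]) (use t s in simp)
  then show ?thesis unfolding above_rest_def drop_ins_Suc[OF t(2)]
    using p(2) by (metis in_set_dropD insert_iff)
qed

lemma above_rest_ins_Suc_Suc: "s \<le> r \<Longrightarrow> r \<le> t \<Longrightarrow> above_rest (ins m s p) (Suc r) (Suc t) \<longleftrightarrow> above_rest p r t"
proof -
  assume t: "s \<le> r" "r \<le> t"
  then have "s \<le> t" by simp
  have "drop (Suc r) (take (Suc t) (ins m s p)) = drop r (take t p)"
    unfolding take_ins_Suc[OF \<open>s \<le> t\<close>] using t s by (simp add: Suc_diff_le)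
  then show ?thesis unfolding above_rest_def drop_ins_Suc[OF \<open>s \<le> t\<close>] by simp
qed

end

lemma above_rest_refl: "above_rest p t t"
  by (simp add: above_rest_def)

text \<open>\<open>Z\<close> describes the admissible sites of \<open>p\<close>: in a pair \<open>(U, v)\<close>, inserting a new maximum at \<open>s < v\<close>
  keeps the site \<open>v\<close> admissible iff \<open>s\<close> does not lie in a set \<open>U'\<close> paired with some \<open>v' > v\<close>, whereas
  the sites in \<open>U\<close> survive only insertions at or to the right of them.\<close>

locale nested =
  fixes p :: "nat list" and Z :: "(nat set \<times> nat) set"
  assumes active_iff: "t \<le> length p \<and> active p t \<longleftrightarrow> (\<exists>(U, v)\<in>Z. t \<in> U \<or> t = v)"
    and less: "(U, v) \<in> Z \<Longrightarrow> (U', v') \<in> Z \<Longrightarrow> v < v' \<Longrightarrow> a \<in> U' \<Longrightarrow> b \<in> U \<Longrightarrow> a < b"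
    and below: "(U, v) \<in> Z \<Longrightarrow> (U', v') \<in> Z \<Longrightarrow> a \<in> U \<Longrightarrow> a < v'"
    and unique: "(U, v) \<in> Z \<Longrightarrow> (U', v) \<in> Z \<Longrightarrow> U = U'"
    and above_rest_iff: "(U, v) \<in> Z \<Longrightarrow> s \<le> length p \<Longrightarrow> active p s \<Longrightarrow> s < v \<Longrightarrow>
        above_rest p s v \<longleftrightarrow> \<not> (\<exists>U' v'. (U', v') \<in> Z \<and> s \<in> U' \<and> v < v')"
    and not_above_rest: "(U, v) \<in> Z \<Longrightarrow> t \<in> U \<Longrightarrow> s < t \<Longrightarrow> active p s \<Longrightarrow> \<not> above_rest p s t"

definition shift_above :: "nat \<Rightarrow> (nat set \<times> nat) set \<Rightarrow> (nat set \<times> nat) set" where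
  "shift_above v Z = {(U, Suc v') |U v'. (U, v') \<in> Z \<and> v < v'}"

text \<open>No site is lost: those up to \<open>v\<close> lie left of \<open>m\<close>, and every
  larger \<open>v'\<close> survives because \<open>v\<close> lies in no set of a pair. All sites of
  the pairs up to \<open>(U, v)\<close> now have \<open>m\<close> on their right, so they survive
  only insertions at or right of them. They form one set \<open>W\<close>, paired with the second
  copy \<open>Suc v\<close> of the site \<open>v\<close>.\<close>

lemma nested_insert_right:
  assumes n: "nested p Z" and p: "distinct p" "\<forall>x\<in>set p. x < m" and z: "(U, v) \<in> Z"
    and W: "W = {t. \<exists>(U', v')\<in>Z. v' \<le> v \<and> (t \<in> U' \<or> t = v')}"
  shows "nested (ins m v p) (insert (W, Suc v) (shift_above v Z))" (is "nested ?q ?Z")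
proof -
  interpret nested p Z by (rule n)
  have v: "v \<le> length p" "active p v" using active_iff[of v] z by blast+
  note ins_le = active_ins_le[OF p v(1)] and ins_Suc = active_ins_Suc[OF p v(1)]
    and above_rest_ins = above_rest_ins_le[OF p v(1)]
      above_rest_ins_Suc[OF p v(1)] above_rest_ins_Suc_Suc[OF p v(1)]
  have len: "length ?q = Suc (length p)" by (simp add: ins_def)
  have Zq: "(U', v') \<in> ?Z \<longleftrightarrow> U' = W \<and> v' = Suc v \<or> (\<exists>v''. v' = Suc v'' \<and> v < v'' \<and> (U', v'') \<in> Z)" for U' v'
    by (auto simp: shift_above_def)
  have Zq_ex: "(\<exists>(U', v')\<in>?Z. P U' v') \<longleftrightarrow> P W (Suc v) \<or> (\<exists>U' v'. (U', v') \<in> Z \<and> v < v' \<and> P U' (Suc v'))" for P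
    by (auto simp: shift_above_def)
  have low: "t < v" if "(U', v') \<in> Z" "t \<in> U'" for U' v' t using that below[OF _ z] by blast
  have W_le: "t \<le> v" if "t \<in> W" for t
    using that low unfolding W by fastforce
  have above: "above_rest p v v'" if "(U', v') \<in> Z" "v < v'" for U' v'
    using above_rest_iff[OF that(1) v that(2)] low by blast
  have sites_le: "active p t \<longleftrightarrow> t \<in> W \<or> (\<exists>U' v'. (U', v') \<in> Z \<and> v < v' \<and> t \<in> U')" if "t \<le> v" for t
  proof -
    have "active p t \<longleftrightarrow> (\<exists>(U, v)\<in>Z. t \<in> U \<or> t = v)" using active_iff[of t] that v by auto
    also have "\<dots> \<longleftrightarrow> t \<in> W \<or> (\<exists>U' v'. (U', v') \<in> Z \<and> v < v' \<and> t \<in> U')"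
    proof
      assume "\<exists>(U, v)\<in>Z. t \<in> U \<or> t = v"
      then obtain U' v' where U': "(U', v') \<in> Z" "t \<in> U' \<or> t = v'" by blast
      show "t \<in> W \<or> (\<exists>U' v'. (U', v') \<in> Z \<and> v < v' \<and> t \<in> U')"
      proof (cases "v' \<le> v")
        case True
        then show ?thesis using U' unfolding W by blast
      next
        case False
        then have "v < v'" "t \<in> U'" using U' that by auto
        then show ?thesis using U'(1) by blast
      qed
    qed (use W in blast)
    finally show ?thesis .
  qed
  have sites_gt: "t \<le> length p \<and> active p t \<and> above_rest p v t \<longleftrightarrow> t = v \<or> (\<exists>U'. (U', t) \<in> Z \<and> v < t)"
    if "v \<le> t" for t
  proof (cases "t = v")
    case True
    then show ?thesis using v above_rest_refl by blast
  next
    case False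
    then have "v < t" using that by simp
    then have "(\<exists>(U', v')\<in>Z. t \<in> U' \<or> t = v') \<longleftrightarrow> (\<exists>U'. (U', t) \<in> Z)" using low by fastforce
    then show ?thesis using active_iff[of t] above \<open>v < t\<close> by blast
  qed
  show ?thesis
  proof
    fix t
    show "t \<le> length ?q \<and> active ?q t \<longleftrightarrow> (\<exists>(U, v)\<in>?Z. t \<in> U \<or> t = v)"
    proof (cases "t \<le> v")
      case True
      then show ?thesis unfolding Zq_ex using ins_le[OF True] sites_le[OF True] v len by auto
    next
      case False
      then obtain r where r: "t = Suc r" "v \<le> r" by (metis Suc_le_D not_less_eq_eq)
      have "t \<notin> W" "\<And>U' v'. (U', v') \<in> Z \<Longrightarrow> t \<notin> U'" using W_le low False by fastforce+
      then have "(\<exists>(U, v)\<in>?Z. t \<in> U \<or> t = v) \<longleftrightarrow> r = v \<or> (\<exists>U'. (U', r) \<in> Z \<and> v < r)"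
        unfolding Zq_ex r(1) by blast
      then show ?thesis using ins_Suc[OF r(2)] sites_gt[OF r(2)] len r(1) by simp
    qed
  next
    show "a < b" if h: "(U1, v1) \<in> ?Z" "(U2, v2) \<in> ?Z" "v1 < v2" "a \<in> U2" "b \<in> U1" for U1 v1 U2 v2 a b
    proof -
      obtain w2 where w2: "v2 = Suc w2" "v < w2" "(U2, w2) \<in> Z"
        using h(1-3) unfolding Zq by auto
      show ?thesis
      proof (cases "U1 = W \<and> v1 = Suc v")
        case True
        then obtain U' v' where "(U', v') \<in> Z" "v' \<le> v" "b \<in> U' \<or> b = v'" using h(5) unfolding W by blast
        then show ?thesis using less[of U' v' U2 w2 a b] below[of U2 w2 U' v' a] w2 h(4) by auto
      next
        case False
        then obtain w1 where "v1 = Suc w1" "(U1, w1) \<in> Z" using h(1) unfolding Zq by auto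
        then show ?thesis using less[of U1 w1 U2 w2 a b] w2 h by simp
      qed
    qed
  next
    show "a < v2" if h: "(U1, v1) \<in> ?Z" "(U2, v2) \<in> ?Z" "a \<in> U1" for U1 v1 U2 v2 a
    proof -
      have "a \<le> v" using h(1,3) W_le low unfolding Zq by (meson less_imp_le)
      moreover have "v < v2" using h(2) unfolding Zq by auto
      ultimately show ?thesis by simp
    qed
  next
    show "U1 = U2" if "(U1, v1) \<in> ?Z" "(U2, v1) \<in> ?Z" for U1 U2 v1
      using that unique unfolding Zq by auto
  next
    fix U1 v1 s
    assume h: "(U1, v1) \<in> ?Z" "s \<le> length ?q" "active ?q s" "s < v1"
    have "v1 = Suc v \<or> (\<exists>v''. v1 = Suc v'' \<and> v < v'' \<and> (U1, v'') \<in> Z)"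
      using h(1) unfolding Zq by blast
    then obtain w U' where w: "v1 = Suc w" "v \<le> w" and U': "(U', w) \<in> Z"
      using z less_imp_le by blast
    have *: "(\<exists>U' v'. (U', v') \<in> ?Z \<and> s \<in> U' \<and> v1 < v') \<longleftrightarrow> (\<exists>U' v'. (U', v') \<in> Z \<and> s \<in> U' \<and> w < v')" (is "?l \<longleftrightarrow> ?r")
    proof
      show ?r if ?l using that w unfolding Zq by auto
      assume ?r
      then obtain U' v' where U': "(U', v') \<in> Z" "s \<in> U'" "w < v'" by blast
      then have "(U', Suc v') \<in> ?Z" "v1 < Suc v'" using w unfolding Zq by simp_all
      then show ?l using U'(2) by blast
    qed
    show "above_rest ?q s v1 \<longleftrightarrow> \<not> (\<exists>U' v'. (U', v') \<in> ?Z \<and> s \<in> U' \<and> v1 < v')"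
    proof (cases "s \<le> v")
      case True
      have "above_rest ?q s v1 \<longleftrightarrow> above_rest p s w" using above_rest_ins(2)[OF True w(2)] w(1) by simp
      also have "\<dots> \<longleftrightarrow> \<not> (\<exists>U' v'. (U', v') \<in> Z \<and> s \<in> U' \<and> w < v')"
      proof (cases "s = w")
        case True
        then show ?thesis using above_rest_refl low w(2) \<open>s \<le> v\<close> by fastforce
      next
        case False
        then have "s < w" "s \<le> length p" "active p s" using True w h v ins_le[OF True] by auto
        then show ?thesis using above_rest_iff[OF U'] by blast
      qed
      finally show ?thesis unfolding * .
    next
      case False
      then obtain r where r: "s = Suc r" "v \<le> r" by (metis Suc_le_D not_less_eq_eq)
      then have "r < w" "r \<le> length p" "active p r" using h len w(1) ins_Suc[OF r(2)] by auto
      then have "above_rest p r w" using above_rest_iff[OF U', of r] low r(2) by fastforce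
      then have "above_rest ?q s v1" using above_rest_ins(3)[OF r(2), of w] \<open>r < w\<close> r(1) w(1) by simp
      moreover have "\<not> (\<exists>U' v'. (U', v') \<in> Z \<and> s \<in> U' \<and> w < v')" using low False by fastforce
      ultimately show ?thesis unfolding * by blast
    qed
  next
    fix U1 v1 s t
    assume h: "(U1, v1) \<in> ?Z" "t \<in> U1" "s < t" "active ?q s"
    then have "t \<le> v" using W_le low unfolding Zq by (meson less_imp_le)
    then show "\<not> above_rest ?q s t" using above_rest_ins(1) \<open>s < t\<close> by blast
  qed
qed

text \<open>The elements of \<open>U\<close> right of \<open>u\<close> and all pairs with smaller
  second component die, while \<open>v\<close> and the pairs further out survive. The site
  \<open>u\<close> splits into \<open>u\<close> and \<open>Suc u\<close>, which form the new
  innermost pair; the rest of \<open>U\<close> stays with \<open>v\<close>.\<close>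

lemma nested_insert_left:
  assumes n: "nested p Z" and p: "distinct p" "\<forall>x\<in>set p. x < m" and z: "(U, v) \<in> Z" and u: "u \<in> U"
  shows "nested (ins m u p) (insert ({t \<in> U. t < u}, Suc v) (insert ({u}, Suc u) (shift_above v Z)))"
    (is "nested ?q (insert (?X, _) ?Z')")
proof -
  interpret nested p Z by (rule n)
  let ?Z = "insert (?X, Suc v) ?Z'"
  have u_act: "u \<le> length p" "active p u" using active_iff[of u] z u by blast+
  have uv: "u < v" using below[OF z z u] .
  note ins_le = active_ins_le[OF p u_act(1)] and ins_Suc = active_ins_Suc[OF p u_act(1)]
    and above_rest_ins = above_rest_ins_le[OF p u_act(1)]
      above_rest_ins_Suc[OF p u_act(1)] above_rest_ins_Suc_Suc[OF p u_act(1)]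
  have len: "length ?q = Suc (length p)" by (simp add: ins_def)
  have Zq: "(U', v') \<in> ?Z \<longleftrightarrow> U' = ?X \<and> v' = Suc v \<or> U' = {u} \<and> v' = Suc u \<or>
      (\<exists>v''. v' = Suc v'' \<and> v < v'' \<and> (U', v'') \<in> Z)" for U' v'
    by (auto simp: shift_above_def)
  have Zq_ex: "(\<exists>(U', v')\<in>?Z. P U' v') \<longleftrightarrow> P ?X (Suc v) \<or> P {u} (Suc u) \<or>
      (\<exists>U' v'. (U', v') \<in> Z \<and> v < v' \<and> P U' (Suc v'))" for P
    by (auto simp: shift_above_def)
  have low: "t < u" if "(U', v') \<in> Z" "v < v'" "t \<in> U'" for U' v' t using less[OF z that u] .
  have U_le: "t \<le> u" if "(U', v') \<in> ?Z" "t \<in> U'" for U' v' t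
    using that low less_imp_le unfolding Zq by blast
  have sites_le: "active p t \<longleftrightarrow> t \<in> ?X \<or> t = u \<or> (\<exists>U' v'. (U', v') \<in> Z \<and> v < v' \<and> t \<in> U')" if t: "t \<le> u" for t
  proof
    assume "active p t"
    then obtain U' v' where U': "(U', v') \<in> Z" "t \<in> U' \<or> t = v'" using active_iff[of t] t u_act by auto
    have "t \<in> U'" using U' below[OF z U'(1) u] t by auto
    consider "v < v'" | "v' = v" | "v' < v" by linarith
    then show "t \<in> ?X \<or> t = u \<or> (\<exists>U' v'. (U', v') \<in> Z \<and> v < v' \<and> t \<in> U')"
    proof cases
      case 1
      then show ?thesis using U' \<open>t \<in> U'\<close> by blast
    next
      case 2
      then have "U' = U" using unique[OF z] U'(1) by blast
      then show ?thesis using \<open>t \<in> U'\<close> t by auto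
    next
      case 3
      then show ?thesis using less[OF U'(1) z 3 u \<open>t \<in> U'\<close>] t by simp
    qed
  next
    assume "t \<in> ?X \<or> t = u \<or> (\<exists>U' v'. (U', v') \<in> Z \<and> v < v' \<and> t \<in> U')"
    then have "\<exists>(U', v')\<in>Z. t \<in> U' \<or> t = v'" using z u by blast
    then show "active p t" using active_iff[of t] by blast
  qed
  have sites_gt: "t \<le> length p \<and> active p t \<and> above_rest p u t \<longleftrightarrow> t = u \<or> (\<exists>U'. (U', t) \<in> Z \<and> v \<le> t)"
    if t: "u \<le> t" for t
  proof (cases "t = u")
    case True
    then show ?thesis using u_act above_rest_refl by blast
  next
    case False
    then have ut: "u < t" using t by simp
    \<comment> \<open>\<open>u\<close> lies in \<open>U\<close>, which blocks every
      \<open>t < v\<close>. The sets paired with something larger than \<open>v\<close> lie entirely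
      left of \<open>u\<close>, so they block nothing here.\<close>
    have eq: "above_rest p u t \<longleftrightarrow> v \<le> t" if "(U', t) \<in> Z" for U'
      using above_rest_iff[OF that u_act ut] z u low by (meson less_irrefl not_le order.strict_trans1)
    show ?thesis
    proof
      assume h: "t \<le> length p \<and> active p t \<and> above_rest p u t"
      then obtain U' v' where U': "(U', v') \<in> Z" "t \<in> U' \<or> t = v'" using active_iff[of t] by auto
      then have "t = v'" using not_above_rest[OF U'(1) _ ut u_act(2)] h by blast
      then show "t = u \<or> (\<exists>U'. (U', t) \<in> Z \<and> v \<le> t)" using eq U' h by blast
    next
      assume "t = u \<or> (\<exists>U'. (U', t) \<in> Z \<and> v \<le> t)"
      then show "t \<le> length p \<and> active p t \<and> above_rest p u t" using False active_iff[of t] eq by blast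
    qed
  qed
  show ?thesis
  proof
    fix t
    show "t \<le> length ?q \<and> active ?q t \<longleftrightarrow> (\<exists>(U, v)\<in>?Z. t \<in> U \<or> t = v)"
    proof (cases "t \<le> u")
      case True
      then show ?thesis unfolding Zq_ex using ins_le[OF True] sites_le[OF True] u_act len uv by auto
    next
      case False
      then obtain r where r: "t = Suc r" "u \<le> r" by (metis Suc_le_D not_less_eq_eq)
      have "t \<notin> U'" if "(U', v') \<in> ?Z" for U' v' using U_le[OF that] False by blast
      then have "(\<exists>(U, v)\<in>?Z. t \<in> U \<or> t = v) \<longleftrightarrow> (\<exists>(U, v)\<in>?Z. t = v)" by blast
      also have "\<dots> \<longleftrightarrow> r = u \<or> (\<exists>U'. (U', r) \<in> Z \<and> v \<le> r)"
        unfolding Zq_ex r(1) using z by (auto simp: le_less)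
      finally show ?thesis using ins_Suc[OF r(2)] sites_gt[OF r(2)] len r(1) by simp
    qed
  next
    show "a < b" if h: "(U1, v1) \<in> ?Z" "(U2, v2) \<in> ?Z" "v1 < v2" "a \<in> U2" "b \<in> U1" for U1 v1 U2 v2 a b
    proof -
      consider "U1 = {u}" "v1 = Suc u" | "U1 = ?X" "v1 = Suc v" | w1 where "v1 = Suc w1" "v < w1" "(U1, w1) \<in> Z"
        using h(1) unfolding Zq by blast
      then show ?thesis
      proof cases
        case 1
        then show ?thesis using h low unfolding Zq by auto
      next
        case 2
        then obtain w2 where "v < w2" "(U2, w2) \<in> Z" using h(2,3) uv unfolding Zq by auto
        then show ?thesis using less[OF z, of U2 w2 a b] 2 h by auto
      next
        case 3
        then obtain w2 where "v2 = Suc w2" "(U2, w2) \<in> Z" using h(2,3) uv unfolding Zq by auto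
        then show ?thesis using less[OF 3(3), of U2 w2 a b] 3 h by auto
      qed
    qed
  next
    show "a < v2" if h: "(U1, v1) \<in> ?Z" "(U2, v2) \<in> ?Z" "a \<in> U1" for U1 v1 U2 v2 a
    proof -
      have "u < v2" using h(2) uv unfolding Zq by auto
      then show ?thesis using U_le[OF h(1,3)] by simp
    qed
  next
    show "U1 = U2" if "(U1, v1) \<in> ?Z" "(U2, v1) \<in> ?Z" for U1 U2 v1
      using that unique uv unfolding Zq by auto
  next
    fix U1 v1 s
    assume h: "(U1, v1) \<in> ?Z" "s \<le> length ?q" "active ?q s" "s < v1"
    show "above_rest ?q s v1 \<longleftrightarrow> \<not> (\<exists>U' v'. (U', v') \<in> ?Z \<and> s \<in> U' \<and> v1 < v')"
    proof (cases "v1 = Suc u")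
      case True
      then have s: "s \<le> u" using h(4) by simp
      have eq: "above_rest ?q s v1 \<longleftrightarrow> above_rest p s u" using above_rest_ins(2)[OF s] True by simp
      show ?thesis
      proof (cases "s = u")
        case True
        have "above_rest ?q s v1" using eq True above_rest_refl by simp
        moreover have "\<not> (\<exists>U' v'. (U', v') \<in> ?Z \<and> s \<in> U' \<and> v1 < v')"
          using low True \<open>v1 = Suc u\<close> unfolding Zq by auto
        ultimately show ?thesis by (intro iffI)
      next
        case False
        have "active p s" using h(3) ins_le[OF s] by simp
        then have "\<not> above_rest p s u" using not_above_rest[OF z u] False s by simp
        moreover have "s \<in> ?X \<or> (\<exists>U' v'. (U', v') \<in> Z \<and> v < v' \<and> s \<in> U')"
          using sites_le[OF s] \<open>active p s\<close> False by blast
        then have "\<exists>U' v'. (U', v') \<in> ?Z \<and> s \<in> U' \<and> v1 < v'"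
          unfolding Zq \<open>v1 = Suc u\<close> using uv Suc_less_eq less_trans by metis
        ultimately show ?thesis using eq by simp
      qed
    next
      case False
      then have "v1 = Suc v \<or> (\<exists>v''. v1 = Suc v'' \<and> v < v'' \<and> (U1, v'') \<in> Z)"
        using h(1) unfolding Zq by blast
      then obtain w U' where w: "v1 = Suc w" "v \<le> w" and U': "(U', w) \<in> Z"
        using z less_imp_le by blast
      have *: "(\<exists>U' v'. (U', v') \<in> ?Z \<and> s \<in> U' \<and> v1 < v') \<longleftrightarrow> (\<exists>U' v'. (U', v') \<in> Z \<and> s \<in> U' \<and> w < v')" (is "?l \<longleftrightarrow> ?r")
      proof
        show ?r if ?l using that w uv unfolding Zq by auto
        assume ?r
        then obtain U' v' where U': "(U', v') \<in> Z" "s \<in> U'" "w < v'" by blast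
        then have "(U', Suc v') \<in> ?Z" "v1 < Suc v'" using w unfolding Zq by simp_all
        then show ?l using U'(2) by blast
      qed
      show ?thesis
      proof (cases "s \<le> u")
        case True
        then have "above_rest ?q s v1 \<longleftrightarrow> above_rest p s w" using above_rest_ins(2)[OF True, of w] w uv by simp
        moreover have "s < w" "s \<le> length p" "active p s" using True w h uv u_act ins_le[OF True] by auto
        ultimately show ?thesis using above_rest_iff[OF U'] unfolding * by blast
      next
        case False
        then obtain r where r: "s = Suc r" "u \<le> r" by (metis Suc_le_D not_less_eq_eq)
        then have r': "r < w" "r \<le> length p" "active p r" using h len w(1) ins_Suc[OF r(2)] by auto
        have "\<not> (\<exists>U' v'. (U', v') \<in> Z \<and> r \<in> U' \<and> w < v')" using low w(2) r(2) by fastforce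
        then have "above_rest p r w" using above_rest_iff[OF U'] r' by blast
        then have "above_rest ?q s v1" using above_rest_ins(3)[OF r(2), of w] r' r(1) w(1) by simp
        moreover have "\<not> (\<exists>U' v'. (U', v') \<in> Z \<and> s \<in> U' \<and> w < v')" using low w(2) False by fastforce
        ultimately show ?thesis unfolding * by blast
      qed
    qed
  next
    fix U1 v1 s t
    assume h: "(U1, v1) \<in> ?Z" "t \<in> U1" "s < t" "active ?q s"
    then have "t \<le> u" using U_le by blast
    then show "\<not> above_rest ?q s t" using above_rest_ins(1) \<open>s < t\<close> by blast
  qed
qed

text \<open>The top pair counts one less because the empty stack already has a successor.\<close>

fun nest_code :: "(nat set \<times> nat) list \<Rightarrow> nat list" where
  "nest_code [] = []"
| "nest_code [(U, v)] = [card U]"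
| "nest_code ((U, v) # z # zs) = (card U + 1) # nest_code (z # zs)"

lemma nest_code_append:
  "zs \<noteq> [] \<Longrightarrow> nest_code (pre @ zs) = map (\<lambda>(U, v). card U + 1) pre @ nest_code zs"
proof (induction pre)
  case (Cons z pre)
  then obtain y ys where "pre @ zs = y # ys" by (metis append_is_Nil_conv neq_Nil_conv)
  with Cons show ?case by (cases z) simp
qed simp

lemma sum_nest_code: "zs \<noteq> [] \<Longrightarrow> 1 + sum_list (nest_code zs) = (\<Sum>(U, v)\<leftarrow>zs. card U + 1)"
  by (induction zs rule: nest_code.induct) auto

abbreviation decreasing :: "(nat set \<times> nat) list \<Rightarrow> bool" where
  "decreasing \<equiv> sorted_wrt (\<lambda>z z'. snd z' < snd z)"

text \<open>The list runs from the outermost pair, the bottom of the stack, to the innermost. A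
  nonempty innermost set makes the top entry positive. The empty word is separate since its single
  site would give \<open>[0]\<close> instead of the empty stack.\<close>

definition nest_state :: "nat list \<Rightarrow> nat list \<Rightarrow> bool" where
  "nest_state p c \<longleftrightarrow> p = [] \<and> c = [] \<or>
     (\<exists>zs. zs \<noteq> [] \<and> nested p (set zs) \<and> decreasing zs \<and> fst (last zs) \<noteq> {} \<and> c = nest_code zs)"

definition sites_of :: "(nat set \<times> nat) list \<Rightarrow> nat set" where
  "sites_of zs = {t. \<exists>(U, v)\<in>set zs. t \<in> U \<or> t = v}"

lemma sites_of_simps [simp]:
  "sites_of [] = {}" "sites_of ((U, v) # zs) = insert v (U \<union> sites_of zs)"
  by (auto simp: sites_of_def)

lemma (in nested) finite_sites: "(U, v) \<in> Z \<Longrightarrow> finite U"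
  by (rule finite_subset[of _ "{..length p}"]) (use active_iff in fastforce)+

lemma (in nested) sites_of_disjoint:
  assumes "set ((U, v) # zs) \<subseteq> Z" "decreasing ((U, v) # zs)"
  shows "v \<notin> U \<union> sites_of zs" "U \<inter> sites_of zs = {}"
proof -
  have z: "(U, v) \<in> Z" using assms(1) by simp
  have "t \<noteq> v \<and> t \<notin> U" if t: "t \<in> sites_of zs" for t
  proof -
    obtain U' v' where U': "(U', v') \<in> set zs" "t \<in> U' \<or> t = v'" using t unfolding sites_of_def by blast
    then have z': "(U', v') \<in> Z" "v' < v" using assms by auto
    from U'(2) show ?thesis
    proof
      assume "t \<in> U'"
      then show ?thesis using below[OF z'(1) z] less[OF z'(1) z z'(2), of t t] by auto
    next
      assume "t = v'"
      then show ?thesis using below[OF z z'(1)] z'(2) by auto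
    qed
  qed
  then show "v \<notin> U \<union> sites_of zs" "U \<inter> sites_of zs = {}" using below[OF z z] by auto
qed

text \<open>With \<open>sum_nest_code\<close> this identifies the size of the set \<open>W\<close>
  in \<open>nested_insert_right\<close> with the merged stack entry.\<close>

lemma (in nested) card_sites_of:
  assumes "set zs \<subseteq> Z" "decreasing zs"
  shows "finite (sites_of zs) \<and> card (sites_of zs) = (\<Sum>(U, v)\<leftarrow>zs. card U + 1)"
  using assms
proof (induction zs)
  case (Cons z zs)
  obtain U v where z: "z = (U, v)" by fastforce
  have "finite U" using Cons.prems finite_sites z by auto
  moreover have "finite (sites_of zs)" "card (sites_of zs) = (\<Sum>(U, v)\<leftarrow>zs. card U + 1)" using Cons by auto
  ultimately show ?case using sites_of_disjoint[of U v zs] Cons.prems z by (simp add: card_Un_disjoint)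
qed simp

lemma decreasing_split:
  assumes "decreasing (pre @ (U, v) # zs)"
  shows "(U', v') \<in> set (pre @ (U, v) # zs) \<and> v < v' \<longleftrightarrow> (U', v') \<in> set pre"
    and "(U', v') \<in> set (pre @ (U, v) # zs) \<and> v' \<le> v \<longleftrightarrow> (U', v') \<in> set ((U, v) # zs)"
proof -
  have "v < v'" if "(U', v') \<in> set pre" using assms that by (auto simp: sorted_wrt_append)
  moreover have "v' < v" if "(U', v') \<in> set zs" using assms that by (auto simp: sorted_wrt_append)
  ultimately show "(U', v') \<in> set (pre @ (U, v) # zs) \<and> v < v' \<longleftrightarrow> (U', v') \<in> set pre"
    "(U', v') \<in> set (pre @ (U, v) # zs) \<and> v' \<le> v \<longleftrightarrow> (U', v') \<in> set ((U, v) # zs)"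
    by auto
qed

lemma set_shift_above:
  assumes "decreasing (pre @ (U, v) # zs)"
  shows "set (map (apsnd Suc) pre) = shift_above v (set (pre @ (U, v) # zs))"
  unfolding shift_above_def decreasing_split(1)[OF assms] by (force simp: image_iff)

text \<open>Ranks are the values to which an entry is cut: insertion at \<open>u\<close> leaves a
  pair whose set holds the smaller elements, and a pair that is not on top is coded by set size plus
  one.\<close>

lemma enumerate_below:
  assumes "finite (U :: nat set)"
  shows "\<exists>us. distinct us \<and> set us = U \<and> list_all2 (\<lambda>u k. k = card {t \<in> U. t < u} + 1) us [1..<Suc (card U)]"
  using assms
proof (induction U rule: finite_linorder_max_induct)
  case empty
  show ?case by simp
next
  case (insert b A)
  then obtain us where us: "distinct us" "set us = A"
      "list_all2 (\<lambda>u k. k = card {t \<in> A. t < u} + 1) us [1..<Suc (card A)]" by blast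
  have b: "b \<notin> A" using insert by auto
  have "list_all2 (\<lambda>u k. k = card {t \<in> insert b A. t < u} + 1) us [1..<Suc (card A)]"
    using us(3)
  proof (rule list.rel_mono_strong)
    fix u k assume "u \<in> set us" "k = card {t \<in> A. t < u} + 1"
    moreover from this have "{t \<in> insert b A. t < u} = {t \<in> A. t < u}" using insert us(2) by fastforce
    ultimately show "k = card {t \<in> insert b A. t < u} + 1" by simp
  qed
  moreover have "{t \<in> insert b A. t < b} = A" using insert by auto
  ultimately have "list_all2 (\<lambda>u k. k = card {t \<in> insert b A. t < u} + 1) (us @ [b]) ([1..<Suc (card A)] @ [Suc (card A)])"
    by (intro list_all2_appendI) simp_all
  moreover have "[1..<Suc (card (insert b A))] = [1..<Suc (card A)] @ [Suc (card A)]"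
    using insert b by simp
  ultimately show ?case using us b by (intro exI[of _ "us @ [b]"]) simp
qed

text \<open>Induction from the outermost pair inwards; \<open>pre\<close> collects the pairs passed,
  whose entries remain fixed. A site of the current pair merges or cuts its entry, and sites of
  inner pairs are left to the induction hypothesis.\<close>

lemma nested_sites:
  assumes n: "nested p (set (pre @ zs))" and d: "decreasing (pre @ zs)" and "zs \<noteq> []" "fst (last zs) \<noteq> {}"
    and p: "distinct p" "\<forall>x\<in>set p. x < m"
  shows "\<exists>sites. distinct sites \<and> set sites = sites_of zs \<and>
    list_all2 (\<lambda>s c. nest_state (ins m s p) (map (\<lambda>(U, v). card U + 1) pre @ c)) sites (succs (nest_code zs))"
  using assms(1-4)
proof (induction zs arbitrary: pre)
  case (Cons z zs)
  obtain U v where z: "z = (U, v)" by fastforce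
  let ?Z = "set (pre @ (U, v) # zs)"
  let ?c = "\<lambda>(U, v). card U + (1::nat)"
  interpret nested p ?Z using Cons.prems z by simp
  have dec: "decreasing (pre @ (U, v) # zs)" and dec': "decreasing ((U, v) # zs)"
    using Cons.prems z by (simp_all add: sorted_wrt_append)
  have Z: "(U, v) \<in> ?Z" by simp
  have fin: "finite U" using finite_sites[OF Z] .
  have pre': "decreasing (map (apsnd Suc) pre)" "\<forall>z\<in>set (map (apsnd Suc) pre). Suc v < snd z"
    using dec by (auto simp: sorted_wrt_append sorted_wrt_map)
  have code_pre: "nest_code (map (apsnd Suc) pre @ ys) = map ?c pre @ nest_code ys" if "ys \<noteq> []" for ys
    using that by (subst nest_code_append) (auto simp: comp_def case_prod_unfold)
  have right: "nest_state (ins m v p) (map ?c pre @ [1 + sum_list (nest_code ((U, v) # zs))])"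
  proof -
    let ?W = "sites_of ((U, v) # zs)"
    have "{t. \<exists>(U', v')\<in>?Z. v' \<le> v \<and> (t \<in> U' \<or> t = v')} = {t. \<exists>(U', v')\<in>set ((U, v) # zs). t \<in> U' \<or> t = v'}"
      using decreasing_split(2)[OF dec] by blast
    then have W: "?W = {t. \<exists>(U', v')\<in>?Z. v' \<le> v \<and> (t \<in> U' \<or> t = v')}"
      unfolding sites_of_def by simp
    let ?ys = "map (apsnd Suc) pre @ [(?W, Suc v)]"
    have "nested (ins m v p) (insert (?W, Suc v) (shift_above v ?Z))"
      by (rule nested_insert_right[OF nested_axioms p Z W])
    then have "nested (ins m v p) (set ?ys)" using set_shift_above[OF dec] by simp
    moreover have "decreasing ?ys" using pre' by (simp add: sorted_wrt_append)
    moreover have "nest_code ?ys = map ?c pre @ [1 + sum_list (nest_code ((U, v) # zs))]"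
      using card_sites_of[of "(U, v) # zs", OF _ dec'] sum_nest_code[of "(U, v) # zs"]
      by (subst code_pre) auto
    ultimately show ?thesis unfolding nest_state_def by (intro disjI2 exI[of _ ?ys]) simp
  qed
  have left: "nest_state (ins m u p) (map ?c pre @ [card {t \<in> U. t < u} + 1, 1])" if u: "u \<in> U" for u
  proof -
    let ?ys = "map (apsnd Suc) pre @ [({t \<in> U. t < u}, Suc v), ({u}, Suc u)]"
    have uv: "u < v" using below[OF Z Z u] .
    have "nested (ins m u p) (set ?ys)"
      using nested_insert_left[OF nested_axioms p Z u] set_shift_above[OF dec] by simp
    moreover have "decreasing ?ys" using pre' uv by (fastforce simp: sorted_wrt_append)
    moreover have "nest_code ?ys = map ?c pre @ [card {t \<in> U. t < u} + 1, 1]"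
      by (subst code_pre) simp_all
    ultimately show ?thesis unfolding nest_state_def by (intro disjI2 exI[of _ ?ys]) simp
  qed
  let ?R = "\<lambda>s c. nest_state (ins m s p) (map ?c pre @ c)"
  obtain us where us: "distinct us" "set us = U" "list_all2 (\<lambda>u k. k = card {t \<in> U. t < u} + 1) us [1..<Suc (card U)]"
    using enumerate_below[OF fin] by blast
  have us_R: "list_all2 (\<lambda>u k. ?R u [k, 1]) us [1..<Suc (card U)]"
    using us(3) by (rule list.rel_mono_strong) (use left us(2) in simp)
  show ?case
  proof (cases zs)
    case Nil
    then have "U \<noteq> {}" using Cons.prems z by simp
    then have pos: "0 < card U" using fin by (simp add: card_gt_0_iff)
    \<comment> \<open>The innermost entry is \<open>card U\<close>, so the largest element of
      \<open>U\<close> keeps it intact and pushes \<open>1\<close>. It is listed first because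
      \<open>succs\<close> begins with the successors that keep the bottom entry.\<close>
    then have "[1..<Suc (card U)] = [1..<card U] @ [card U]" by simp
    then obtain us' u where u: "us = us' @ [u]" "list_all2 (\<lambda>u k. ?R u [k, 1]) us' [1..<card U]" "?R u [card U, 1]"
      using us_R by (auto simp: list_all2_append2 list_all2_Cons2)
    have "list_all2 ?R (u # v # us') (succs (nest_code (z # zs)))"
      using u right by (simp add: Nil z list_all2_map2 del: upt_Suc)
    moreover have "distinct (u # v # us')" "set (u # v # us') = sites_of (z # zs)"
      using us(1,2) u(1) sites_of_disjoint(1)[of U v "[]"] Nil z by auto
    ultimately show ?thesis by blast
  next
    case (Cons y ys)
    obtain sites where sites: "distinct sites" "set sites = sites_of zs"
      "list_all2 (\<lambda>s c. nest_state (ins m s p) (map ?c (pre @ [z]) @ c)) sites (succs (nest_code zs))"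
      using Cons.IH[of "pre @ [z]"] Cons.prems Cons by auto
    have "list_all2 ?R sites (map ((#) (card U + 1)) (succs (nest_code zs)))"
      using sites(3) by (simp add: list_all2_map2 z)
    moreover have "list_all2 ?R us (map (\<lambda>b'. [b', 1]) [1..<card U + 1])"
      using us_R by (simp add: list_all2_map2 del: upt_Suc)
    moreover have "?R v [1 + (card U + 1) + sum_list (nest_code zs)]" using right by (simp add: Cons)
    ultimately have "list_all2 ?R (sites @ v # us) (succs (nest_code (z # zs)))"
      using z unfolding Cons by (simp add: list_all2_appendI del: upt_Suc)
    moreover have "distinct (sites @ v # us)" "set (sites @ v # us) = sites_of (z # zs)"
      using us(1,2) sites(1,2) sites_of_disjoint[OF _ dec'] z by auto
    ultimately show ?thesis by blast
  qed
qed simp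

theorem card_no_3142: "card {p \<in> permutations_of_set {1..n}. \<not> has_3142 p} = length (walk n)"
proof (rule card_by_simulation[where R = nest_state])
  show "\<not> has_3142 []" by (simp add: has_3142_def)
  show "nest_state [] []" by (simp add: nest_state_def)
  show "\<not> has_3142 p" if "\<not> has_3142 (ins m i p)" for m i p
    using that has_3142_mono[OF _ subseq_insert[of "take i p" "drop i p" m]] by (auto simp: ins_def)
next
  fix n p c
  assume p: "p \<in> permutations_of_set {1..n}" and no: "\<not> has_3142 p" and st: "nest_state p c"
  have p': "distinct p" "set p = {1..n}" using p by (auto simp: permutations_of_set_def)
  then have len: "length p = n" using distinct_card by fastforce
  have lt: "\<forall>x\<in>set p. x < Suc n" using p' by auto
  have act: "{i. i \<le> n \<and> \<not> has_3142 (ins (Suc n) i p)} = {i. i \<le> length p \<and> active p i}"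
    using has_3142_ins_max[OF lt no] len by simp
  consider "p = []" "c = []" | zs where "zs \<noteq> []" "nested p (set zs)" "decreasing zs" "fst (last zs) \<noteq> {}" "c = nest_code zs"
    using st unfolding nest_state_def by blast
  then show "\<exists>sites. distinct sites \<and> set sites = {i. i \<le> n \<and> \<not> has_3142 (ins (Suc n) i p)} \<and>
      list_all2 (\<lambda>i. nest_state (ins (Suc n) i p)) sites (succs c)"
  proof cases
    case 1
    have "active [x] t" for x t by (cases t) (auto simp: active_def)
    moreover have "\<not> above_rest [x] 0 t \<longleftrightarrow> False" for x t by (cases t) (auto simp: above_rest_def)
    ultimately have "nested [Suc n] (set [({0}, 1)])" by unfold_locales auto
    then have "nest_state (ins (Suc n) 0 p) [1]"
      unfolding nest_state_def by (intro disjI2 exI[of _ "[({0}, 1)]"]) (simp add: 1 ins_def)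
    moreover have "active [] 0" by (simp add: active_def)
    ultimately show ?thesis unfolding act using 1 by (intro exI[of _ "[0]"]) auto
  next
    case 2
    have "sites_of zs = {i. i \<le> length p \<and> active p i}"
      using nested.active_iff[OF 2(2)] unfolding sites_of_def by blast
    then show ?thesis unfolding act using nested_sites[of p "[]" zs "Suc n"] 2 p' lt by simp
  qed
qed

section \<open>Symmetries of pattern avoidance\<close>

lemma ex_list4: "(\<exists>u. length u = 4 \<and> P u) \<longleftrightarrow> (\<exists>a b c d. P [a, b, c, d])"
proof
  show "\<exists>a b c d. P [a, b, c, d]" if "\<exists>u. length u = 4 \<and> P u"
    using that by (auto simp: length_Suc_conv eval_nat_numeral)
  assume "\<exists>a b c d. P [a, b, c, d]"
  then obtain a b c d where "P [a, b, c, d]" by blast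
  then show "\<exists>u. length u = 4 \<and> P u" by (intro exI[of _ "[a, b, c, d]"]) simp
qed

lemma all_less_4: "(\<forall>i<4::nat. P i) \<longleftrightarrow> P 0 \<and> P 1 \<and> P 2 \<and> P 3"
  by (auto simp: less_Suc_eq eval_nat_numeral)

lemma order_isomorphic_quadruple:
  assumes "length u = 4" "length t = 4"
  shows "order_isomorphic u t \<longleftrightarrow> (\<forall>i<4. \<forall>j<4. u ! i < u ! j \<longleftrightarrow> t ! i < t ! j)"
  using assms by (simp add: order_isomorphic_def)

lemma avoids_quadruple:
  assumes "length t = 4"
  shows "avoids p t \<longleftrightarrow> \<not> (\<exists>a b c d. subseq [a, b, c, d] p \<and> order_isomorphic [a, b, c, d] t)"
proof -
  have "order_isomorphic u t \<Longrightarrow> length u = 4" for u using assms by (simp add: order_isomorphic_def)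
  then have "(\<exists>u. subseq u p \<and> order_isomorphic u t) \<longleftrightarrow> (\<exists>u. length u = 4 \<and> subseq u p \<and> order_isomorphic u t)" by blast
  then show ?thesis unfolding avoids_def ex_list4 by simp
qed

lemma avoids_4132: "avoids p [4, 1, 3, 2] \<longleftrightarrow> \<not> has_4132 p"
proof -
  have iso: "order_isomorphic [d, a, b, c] [4, 1, 3, 2] \<longleftrightarrow> a < c \<and> c < b \<and> b < d" for a b c d
    by (subst order_isomorphic_quadruple) (auto simp: all_less_4)
  have "avoids p [4, 1, 3, 2] \<longleftrightarrow> \<not> (\<exists>a b c d. subseq [a, b, c, d] p \<and> order_isomorphic [a, b, c, d] [4, 1, 3, 2])"
    by (rule avoids_quadruple) simp
  then show ?thesis unfolding iso has_4132_def by blast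
qed

lemma avoids_3142: "avoids p [3, 1, 4, 2] \<longleftrightarrow> \<not> has_3142 p"
proof -
  have iso: "order_isomorphic [c, a, d, b] [3, 1, 4, 2] \<longleftrightarrow> a < b \<and> b < c \<and> c < d" for a b c d
    by (subst order_isomorphic_quadruple) (auto simp: all_less_4)
  have "avoids p [3, 1, 4, 2] \<longleftrightarrow> \<not> (\<exists>a b c d. subseq [a, b, c, d] p \<and> order_isomorphic [a, b, c, d] [3, 1, 4, 2])"
    by (rule avoids_quadruple) simp
  then show ?thesis unfolding iso has_3142_def by blast
qed

definition avoiders :: "nat list \<Rightarrow> nat \<Rightarrow> nat list set" where
  "avoiders t n = {p \<in> permutations_of_set {1..n}. avoids p t}"

lemma finite_avoiders: "finite (avoiders t n)"
  by (simp add: avoiders_def)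

lemma card_eq_by_maps:
  assumes "finite A" "finite B"
    and "\<And>x. x \<in> A \<Longrightarrow> f x \<in> B \<and> g (f x) = x" and "\<And>y. y \<in> B \<Longrightarrow> g y \<in> A \<and> f (g y) = y"
  shows "card A = card B"
  by (rule bij_betw_same_card[of f], rule bij_betw_byWitness[of _ g]) (use assms in auto)

section \<open>Reversal and complement\<close>

lemma avoids_rev: "avoids (rev p) (rev t) \<longleftrightarrow> avoids p t"
proof -
  have "\<not> avoids (rev p) (rev t)" if "\<not> avoids p t" for p t
  proof -
    obtain u where u: "subseq u p" "order_isomorphic u t" using \<open>\<not> avoids p t\<close> by (auto simp: avoids_def)
    have "subseq (rev u) (rev p)" using u(1)
    proof induction
      case (list_emb_Cons xs ys y)
      then show ?case by (simp add: subseq_rev_drop_many)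
    next
      case (list_emb_Cons2 x y xs ys)
      then show ?case by (simp add: list_emb_append_mono)
    qed simp
    moreover have "order_isomorphic (rev u) (rev t)"
      using u(2) unfolding order_isomorphic_def by (auto simp: rev_nth)
    ultimately show ?thesis by (auto simp: avoids_def)
  qed
  from this[of p t] this[of "rev p" "rev t"] show ?thesis by auto
qed

lemma card_avoiders_rev: "card (avoiders (rev t) n) = card (avoiders t n)"
proof (rule card_eq_by_maps[where f = rev and g = rev])
  show "rev p \<in> avoiders t n \<and> rev (rev p) = p" if "p \<in> avoiders (rev t) n" for p
    using that avoids_rev[of "rev p" t] by (auto simp: avoiders_def permutations_of_set_def)
  show "rev p \<in> avoiders (rev t) n \<and> rev (rev p) = p" if "p \<in> avoiders t n" for p
    using that avoids_rev[of p t] by (auto simp: avoiders_def permutations_of_set_def)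
qed (rule finite_avoiders)+

text \<open>Subtraction is truncated, so order is strictly reversed only on values up to
  \<open>n + 1\<close>; this explains the bounds on \<open>p\<close> and \<open>t\<close>
  below.\<close>

definition complement :: "nat \<Rightarrow> nat list \<Rightarrow> nat list" where
  "complement n = map (\<lambda>x. n + 1 - x)"

lemma complement_complement: "set p \<subseteq> {1..n} \<Longrightarrow> complement n (complement n p) = p"
  by (auto simp: complement_def intro!: map_idI)

lemma not_avoids_complement:
  assumes "set p \<subseteq> {1..n}" "set t \<subseteq> {1..k}" "\<not> avoids p t"
  shows "\<not> avoids (complement n p) (complement k t)"
proof -
  obtain u where u: "subseq u p" "order_isomorphic u t" using assms(3) by (auto simp: avoids_def)
  have "set u \<subseteq> {1..n}" using subseq_set[OF u(1)] assms(1) by simp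
  then have "\<And>i. i < length u \<Longrightarrow> u ! i \<in> {1..n}" by (meson nth_mem subsetD)
  moreover have "\<And>i. i < length t \<Longrightarrow> t ! i \<in> {1..k}" using assms(2) by (meson nth_mem subsetD)
  moreover have flip: "x \<in> {1..m} \<Longrightarrow> y \<in> {1..m} \<Longrightarrow> m + 1 - x < m + 1 - y \<longleftrightarrow> y < x" for x y m :: nat
    by auto
  ultimately have "order_isomorphic (complement n u) (complement k t)"
    using u(2) unfolding order_isomorphic_def complement_def by (simp add: flip del: atLeastAtMost_iff)
  moreover have "subseq (complement n u) (complement n p)"
    unfolding complement_def using u(1) by (rule subseq_map)
  ultimately show ?thesis by (auto simp: avoids_def)
qed

lemma set_complement: "set p = {1..n} \<Longrightarrow> set (complement n p) = {1..n}"
proof -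
  assume p: "set p = {1..n}"
  have "(\<lambda>x. n + 1 - x) ` {1..n} = {1..n}"
  proof (intro equalityI subsetI)
    fix x assume "x \<in> {1..n}"
    then show "x \<in> (\<lambda>x. n + 1 - x) ` {1..n}" by (intro image_eqI[where x = "n + 1 - x"]) auto
  qed auto
  then show ?thesis by (simp only: complement_def set_map p)
qed

lemma card_avoiders_complement:
  assumes t: "set t \<subseteq> {1..k}"
  shows "card (avoiders (complement k t) n) = card (avoiders t n)"
proof (rule card_eq_by_maps[where f = "complement n" and g = "complement n"])
  have t': "set (complement k t) \<subseteq> {1..k}" using t by (fastforce simp: complement_def)
  have perm: "complement n p \<in> permutations_of_set {1..n}" if "p \<in> permutations_of_set {1..n}" for p
  proof -
    have p: "set p = {1..n}" "distinct p" using that by (auto simp: permutations_of_set_def)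
    have "distinct (complement n p)" unfolding complement_def distinct_map p(1) using p(2) by (auto simp: inj_on_def)
    then show ?thesis using set_complement[OF p(1)] by (simp add: permutations_of_set_def)
  qed
  have sub: "set p \<subseteq> {1..n}" if "p \<in> permutations_of_set {1..n}" for p
    using that by (auto simp: permutations_of_set_def)
  show "complement n p \<in> avoiders t n \<and> complement n (complement n p) = p"
    if "p \<in> avoiders (complement k t) n" for p
  proof -
    have p: "p \<in> permutations_of_set {1..n}" "avoids p (complement k t)" using that by (auto simp: avoiders_def)
    show ?thesis using not_avoids_complement[OF sub[OF perm[OF p(1)]] t] p perm[OF p(1)]
      complement_complement[OF sub[OF p(1)]] by (auto simp: avoiders_def)
  qed
  show "complement n p \<in> avoiders (complement k t) n \<and> complement n (complement n p) = p"
    if "p \<in> avoiders t n" for p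
  proof -
    have p: "p \<in> permutations_of_set {1..n}" "avoids p t" using that by (auto simp: avoiders_def)
    show ?thesis using not_avoids_complement[OF sub[OF perm[OF p(1)]] t'] p perm[OF p(1)]
      complement_complement[OF sub[OF p(1)]] complement_complement[OF t] by (auto simp: avoiders_def)
  qed
qed (rule finite_avoiders)+

section \<open>Inverse permutations\<close>

lemma subseq_iff_positions:
  "subseq u p \<longleftrightarrow> (\<exists>f. (\<forall>i<length u. f i < length p \<and> u ! i = p ! f i) \<and> (\<forall>i j. i < j \<longrightarrow> j < length u \<longrightarrow> f i < f j))"
proof
  assume "subseq u p"
  then show "\<exists>f. (\<forall>i<length u. f i < length p \<and> u ! i = p ! f i) \<and> (\<forall>i j. i < j \<longrightarrow> j < length u \<longrightarrow> f i < f j)"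
  proof induction
    case (list_emb_Nil ys)
    show ?case by simp
  next
    case (list_emb_Cons xs ys y)
    then obtain f where "\<forall>i<length xs. f i < length ys \<and> xs ! i = ys ! f i" "\<forall>i j. i < j \<longrightarrow> j < length xs \<longrightarrow> f i < f j" by blast
    then show ?case by (intro exI[of _ "\<lambda>i. Suc (f i)"]) auto
  next
    case (list_emb_Cons2 x y xs ys)
    then obtain f where f: "\<forall>i<length xs. f i < length ys \<and> xs ! i = ys ! f i" "\<forall>i j. i < j \<longrightarrow> j < length xs \<longrightarrow> f i < f j" by blast
    define g where "g i = (case i of 0 \<Rightarrow> 0 | Suc j \<Rightarrow> Suc (f j))" for i
    have "g i < length (y # ys) \<and> (x # xs) ! i = (y # ys) ! g i" if "i < length (x # xs)" for i
      using that f(1) list_emb_Cons2.hyps by (cases i) (auto simp: g_def)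
    moreover have "g i < g j" if "i < j" "j < length (x # xs)" for i j
      using that f(2) by (cases i; cases j) (auto simp: g_def)
    ultimately show ?case by blast
  qed
next
  assume "\<exists>f. (\<forall>i<length u. f i < length p \<and> u ! i = p ! f i) \<and> (\<forall>i j. i < j \<longrightarrow> j < length u \<longrightarrow> f i < f j)"
  then obtain f where f: "\<forall>i<length u. f i < length p \<and> u ! i = p ! f i" "\<forall>i j. i < j \<longrightarrow> j < length u \<longrightarrow> f i < f j" by blast
  \<comment> \<open>Stated for prefixes so that the induction can cut \<open>p\<close> right after
    the position of the last matched letter.\<close>
  have "subseq (take k u) (take m p)" if "k \<le> length u" "\<forall>i<k. f i < m" "m \<le> length p" for k m
    using that
  proof (induction k arbitrary: m)
    case (Suc k)
    have "subseq (take k u) (take (f k) p)" using Suc f by auto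
    moreover have "take (Suc k) u = take k u @ [p ! f k]" using Suc f(1) by (simp add: take_Suc_conv_app_nth)
    moreover have "take (Suc (f k)) p = take (f k) p @ [p ! f k]" using Suc f(1) by (simp add: take_Suc_conv_app_nth)
    ultimately have "subseq (take (Suc k) u) (take (Suc (f k)) p)" by (simp add: list_emb_append_mono)
    moreover have "take (Suc (f k)) p = take (Suc (f k)) (take m p)" using Suc.prems by (simp add: min_absorb1 Suc_le_eq)
    then have "subseq (take (Suc (f k)) p) (take m p)" by (metis prefix_imp_subseq take_is_prefix)
    ultimately show ?case by (rule subseq_order.trans)
  qed simp
  from this[of "length u" "length p"] f(1) show "subseq u p" by simp
qed

text \<open>Inversion exchanges positions and values, so an occurrence has to be given by its
  positions.\<close>

lemma not_avoids_iff_positions: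
  "\<not> avoids p t \<longleftrightarrow> (\<exists>f. (\<forall>i<length t. f i < length p) \<and> (\<forall>i j. i < j \<longrightarrow> j < length t \<longrightarrow> f i < f j) \<and>
     (\<forall>i<length t. \<forall>j<length t. p ! f i < p ! f j \<longleftrightarrow> t ! i < t ! j))" (is "_ \<longleftrightarrow> ?r")
proof
  assume "\<not> avoids p t"
  then obtain u f where "order_isomorphic u t" "\<forall>i<length u. f i < length p \<and> u ! i = p ! f i"
     "\<forall>i j. i < j \<longrightarrow> j < length u \<longrightarrow> f i < f j" unfolding avoids_def subseq_iff_positions by blast
  then show ?r unfolding order_isomorphic_def by (intro exI[of _ f]) auto
next
  assume ?r
  then obtain f where f: "\<forall>i<length t. f i < length p" "\<forall>i j. i < j \<longrightarrow> j < length t \<longrightarrow> f i < f j"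
     "\<forall>i<length t. \<forall>j<length t. p ! f i < p ! f j \<longleftrightarrow> t ! i < t ! j" by blast
  let ?u = "map (\<lambda>i. p ! f i) [0..<length t]"
  have "subseq ?u p" unfolding subseq_iff_positions using f by (intro exI[of _ f]) simp
  moreover have "order_isomorphic ?u t" using f by (simp add: order_isomorphic_def)
  ultimately show "\<not> avoids p t" by (auto simp: avoids_def)
qed

text \<open>Positions start at \<open>0\<close> and values at \<open>1\<close>, hence the
  \<open>Suc\<close>.\<close>

definition inverse_word :: "nat list \<Rightarrow> nat list" where
  "inverse_word p = map (\<lambda>v. Suc (THE i. i < length p \<and> p ! i = v)) [1..<Suc (length p)]"

lemma inverse_word:
  assumes "p \<in> permutations_of_set {1..n}"
  shows "length p = n" "length (inverse_word p) = n"
    and "i < n \<Longrightarrow> p ! i \<in> {1..n} \<and> inverse_word p ! (p ! i - 1) = Suc i"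
    and "i < n \<Longrightarrow> inverse_word p ! i \<in> {1..n} \<and> p ! (inverse_word p ! i - 1) = Suc i"
proof -
  have p: "distinct p" "set p = {1..n}" using assms by (auto simp: permutations_of_set_def)
  show len: "length p = n" using distinct_card[OF p(1)] p(2) by simp
  then show "length (inverse_word p) = n" by (simp add: inverse_word_def)
  have inv: "inverse_word p ! (p ! i - 1) = Suc i \<and> p ! i \<in> {1..n}" if "i < n" for i
  proof -
    have v: "p ! i \<in> {1..n}" using that len p(2) nth_mem by blast
    have "(THE j. j < length p \<and> p ! j = p ! i) = i"
      using that len p(1) by (intro the_equality) (auto simp: nth_eq_iff_index_eq)
    moreover have "p ! i - 1 < length [1..<Suc (length p)]" "[1..<Suc (length p)] ! (p ! i - 1) = p ! i"
      using v len by (auto simp: nth_upt simp del: upt_Suc)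
    ultimately show ?thesis using v unfolding inverse_word_def by (simp only: nth_map)
  qed
  then show "i < n \<Longrightarrow> p ! i \<in> {1..n} \<and> inverse_word p ! (p ! i - 1) = Suc i" by blast
  assume "i < n"
  then have "Suc i \<in> set p" using p(2) by simp
  then obtain j where j: "j < n" "p ! j = Suc i" using len by (metis in_set_conv_nth)
  then show "inverse_word p ! i \<in> {1..n} \<and> p ! (inverse_word p ! i - 1) = Suc i" using inv[OF j(1)] by simp
qed

lemma inverse_word_permutation:
  assumes "p \<in> permutations_of_set {1..n}"
  shows "inverse_word p \<in> permutations_of_set {1..n}"
proof -
  note inv = inverse_word[OF assms]
  have "distinct (inverse_word p)"
    unfolding distinct_conv_nth inv(2) using inv(4) by (metis Suc_inject)
  moreover have "set (inverse_word p) \<subseteq> {1..n}"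
    using inv(2,4) by (auto simp: in_set_conv_nth)
  ultimately have "set (inverse_word p) = {1..n}"
    using inv(2) distinct_card[of "inverse_word p"] by (intro card_subset_eq) auto
  then show ?thesis using \<open>distinct _\<close> by (simp add: permutations_of_set_def)
qed

lemma inverse_word_inverse_word:
  assumes "p \<in> permutations_of_set {1..n}"
  shows "inverse_word (inverse_word p) = p"
proof (rule nth_equalityI)
  note inv = inverse_word[OF assms] and inv' = inverse_word[OF inverse_word_permutation[OF assms]]
  show "length (inverse_word (inverse_word p)) = length p" using inv inv' by simp
  fix i assume "i < length (inverse_word (inverse_word p))"
  then have i: "i < n" using inv' by simp
  then have "p ! i - 1 < n" "inverse_word p ! (p ! i - 1) = Suc i" "1 \<le> p ! i" using inv(3)[OF i] by auto
  then show "inverse_word (inverse_word p) ! i = p ! i" using inv'(3)[of "p ! i - 1"] by simp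
qed

text \<open>An occurrence of \<open>t\<close> in \<open>p\<close> at positions \<open>f\<close> is an occurrence of the inverse pattern in the
  inverse word, at positions given by the values of \<open>p\<close> on \<open>f\<close>.\<close>

lemma not_avoids_inverse_word:
  assumes p: "p \<in> permutations_of_set {1..n}" and t: "t \<in> permutations_of_set {1..k}"
    and "\<not> avoids p t"
  shows "\<not> avoids (inverse_word p) (inverse_word t)"
proof -
  note ip = inverse_word[OF p] and it = inverse_word[OF t]
  obtain f where f: "\<forall>i<k. f i < n" "\<forall>i j. i < j \<longrightarrow> j < k \<longrightarrow> f i < f j"
     "\<forall>i<k. \<forall>j<k. p ! f i < p ! f j \<longleftrightarrow> t ! i < t ! j"
    using assms(3) unfolding not_avoids_iff_positions ip(1) it(1) by blast
  \<comment> \<open>\<open>h\<close> lists the positions of \<open>t\<close> by increasing value,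
    which makes \<open>g\<close> increasing.\<close>
  define h where "h i = inverse_word t ! i - 1" for i
  define g where "g i = p ! f (h i) - 1" for i
  have h: "h i < k" "inverse_word t ! i = Suc (h i)" "t ! h i = Suc i" if "i < k" for i
    using it(4)[OF that] by (auto simp: h_def)
  have val: "p ! f (h i) = Suc (g i)" "g i < n" "inverse_word p ! g i = Suc (f (h i))" if "i < k" for i
  proof -
    have "f (h i) < n" using h(1)[OF that] f(1) by simp
    from ip(3)[OF this] show "p ! f (h i) = Suc (g i)" "g i < n" "inverse_word p ! g i = Suc (f (h i))"
      by (auto simp: g_def)
  qed
  have "g i < g j" if "i < j" "j < k" for i j
  proof -
    have "p ! f (h i) < p ! f (h j)" using f(3) h(1,3)[of i] h(1,3)[of j] that by simp
    then show ?thesis using val(1)[of i] val(1)[of j] that by simp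
  qed
  moreover have "inverse_word p ! g i < inverse_word p ! g j \<longleftrightarrow> inverse_word t ! i < inverse_word t ! j"
    if "i < k" "j < k" for i j
  proof -
    have "f (h i) < f (h j) \<longleftrightarrow> h i < h j"
      using f(2) h(1)[OF that(1)] h(1)[OF that(2)] by (metis linorder_neqE_nat order.asym less_irrefl)
    then show ?thesis using val(3) h(2) that by simp
  qed
  ultimately show ?thesis unfolding not_avoids_iff_positions ip(2) it(2)
    using val(2) by (intro exI[of _ g]) simp
qed

lemma card_avoiders_inverse:
  assumes t: "t \<in> permutations_of_set {1..k}"
  shows "card (avoiders (inverse_word t) n) = card (avoiders t n)"
proof (rule card_eq_by_maps[where f = inverse_word and g = inverse_word])
  show "inverse_word p \<in> avoiders t n \<and> inverse_word (inverse_word p) = p"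
    if "p \<in> avoiders (inverse_word t) n" for p
  proof -
    have p: "p \<in> permutations_of_set {1..n}" "avoids p (inverse_word t)" using that by (auto simp: avoiders_def)
    show ?thesis using not_avoids_inverse_word[OF inverse_word_permutation[OF p(1)] t] p
      inverse_word_permutation[OF p(1)] inverse_word_inverse_word[OF p(1)] by (auto simp: avoiders_def)
  qed
  show "inverse_word p \<in> avoiders (inverse_word t) n \<and> inverse_word (inverse_word p) = p"
    if "p \<in> avoiders t n" for p
  proof -
    have p: "p \<in> permutations_of_set {1..n}" "avoids p t" using that by (auto simp: avoiders_def)
    show ?thesis
      using not_avoids_inverse_word[OF inverse_word_permutation[OF p(1)] inverse_word_permutation[OF t]] p
      inverse_word_permutation[OF p(1)] inverse_word_inverse_word[OF p(1)] inverse_word_inverse_word[OF t]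
      by (auto simp: avoiders_def)
  qed
qed (rule finite_avoiders)+

section \<open>Decomposition at the first block\<close>

definition direct_sum :: "nat list \<Rightarrow> nat list \<Rightarrow> nat list" where
  "direct_sum p q = p @ map ((+) (length p)) q"

text \<open>Every cut is crossed by an inversion. For permutations this is indecomposability, in a
  form that transfers along \<open>order_isomorphic\<close>.\<close>

definition sum_indecomposable :: "nat list \<Rightarrow> bool" where
  "sum_indecomposable t \<longleftrightarrow> (\<forall>k. 0 < k \<longrightarrow> k < length t \<longrightarrow> (\<exists>i<k. \<exists>j. k \<le> j \<and> j < length t \<and> t ! j < t ! i))"

lemma avoids_mono: "avoids q t \<Longrightarrow> subseq p q \<Longrightarrow> avoids p t"
  unfolding avoids_def by (meson subseq_order.trans)

lemma avoids_shift: "avoids (map ((+) k) p) t \<longleftrightarrow> avoids p t"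
  unfolding avoids_def
proof (intro arg_cong[of _ _ Not] iffI)
  assume "\<exists>u. subseq u (map ((+) k) p) \<and> order_isomorphic u t"
  then obtain u where u: "subseq u (map ((+) k) p)" "order_isomorphic u t" by blast
  then obtain N where "u = map ((+) k) (nths p N)" by (auto simp: subseq_conv_nths nths_map)
  moreover have "subseq (nths p N) p" by (auto simp: subseq_conv_nths)
  ultimately show "\<exists>u. subseq u p \<and> order_isomorphic u t" using u(2) by (auto simp: order_isomorphic_def)
next
  assume "\<exists>u. subseq u p \<and> order_isomorphic u t"
  then obtain u where "subseq u p" "order_isomorphic u t" by blast
  then have "subseq (map ((+) k) u) (map ((+) k) p)" "order_isomorphic (map ((+) k) u) t"
    by (auto simp: order_isomorphic_def intro: subseq_map)
  then show "\<exists>u. subseq u (map ((+) k) p) \<and> order_isomorphic u t" by blast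
qed

text \<open>An occurrence straddling the cut would split \<open>t\<close> into two nonempty parts
  with no inversion between them.\<close>

lemma avoids_append_less:
  assumes t: "sum_indecomposable t" and less: "\<forall>x\<in>set p. \<forall>y\<in>set q. x < y"
  shows "avoids (p @ q) t \<longleftrightarrow> avoids p t \<and> avoids q t"
proof
  assume "avoids (p @ q) t"
  then show "avoids p t \<and> avoids q t"
    using avoids_mono[of "p @ q" t p] avoids_mono[of "p @ q" t q] by (simp add: subseq_drop_many subseq_rev_drop_many)
next
  assume pq: "avoids p t \<and> avoids q t"
  show "avoids (p @ q) t"
    unfolding avoids_def
  proof
    assume "\<exists>u. subseq u (p @ q) \<and> order_isomorphic u t"
    then obtain v w where u: "subseq v p" "subseq w q" "order_isomorphic (v @ w) t"
      by (auto simp: subseq_append_iff)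
    have "v \<noteq> []" "w \<noteq> []" using u pq by (auto simp: avoids_def)
    moreover have len: "length t = length v + length w" using u(3) by (simp add: order_isomorphic_def)
    ultimately obtain i j where ij: "i < length v" "length v \<le> j" "j < length t" "t ! j < t ! i"
      using t unfolding sum_indecomposable_def by (metis length_greater_0_conv less_add_same_cancel1)
    then have "(v @ w) ! j < (v @ w) ! i" using u(3) len unfolding order_isomorphic_def by simp
    moreover have "(v @ w) ! j \<in> set w" "(v @ w) ! i \<in> set v" using ij len by (simp_all add: nth_append)
    ultimately show False using less subseq_set[OF u(1)] subseq_set[OF u(2)] by (meson order.asym subsetD)
  qed
qed

lemma permutations_of_set_interval_iff:
  "p \<in> permutations_of_set {1..n} \<longleftrightarrow> length p = n \<and> set p = {1..n} \<and> distinct p"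
  using distinct_card[of p] by (auto simp: permutations_of_set_def)

lemma first_block_index:
  assumes p: "p \<in> permutations_of_set {1..n}" and "0 < n"
  shows "first_block_index p \<in> {1..n}" "set (take (first_block_index p) p) = {1..first_block_index p}"
    and "i \<in> {1..n} \<Longrightarrow> set (take i p) = {1..i} \<Longrightarrow> first_block_index p \<le> i"
proof -
  have len: "length p = n" "set p = {1..n}" using p unfolding permutations_of_set_interval_iff by blast+
  let ?P = "\<lambda>i. i \<in> {1..length p} \<and> set (take i p) = {1..i}"
  have "?P n" using len \<open>0 < n\<close> by simp
  then have "?P (first_block_index p)" unfolding first_block_index_def by (rule LeastI)
  then show "first_block_index p \<in> {1..n}" "set (take (first_block_index p) p) = {1..first_block_index p}"
    unfolding len(1) by blast+
  show "first_block_index p \<le> i" if "i \<in> {1..n}" "set (take i p) = {1..i}"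
    unfolding first_block_index_def using that by (intro Least_le) (simp add: len(1))
qed

definition indecomposables :: "nat list \<Rightarrow> nat \<Rightarrow> nat list set" where
  "indecomposables t n = {p \<in> avoiders t n. indecomposable p}"

lemma direct_sum_permutation:
  assumes "p \<in> permutations_of_set {1..k}" "q \<in> permutations_of_set {1..l}"
  shows "direct_sum p q \<in> permutations_of_set {1..k + l}"
proof -
  have p: "length p = k" "set p = {1..k}" "distinct p" and q: "length q = l" "set q = {1..l}" "distinct q"
    using assms unfolding permutations_of_set_interval_iff by blast+
  have "set (map ((+) k) q) = {k + 1..k + l}" using q(2) by simp
  moreover have "distinct (map ((+) k) q)" using q(3) by (simp add: distinct_map)
  ultimately show ?thesis unfolding permutations_of_set_interval_iff using p q(1) by (auto simp: direct_sum_def)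
qed

lemma first_block_index_direct_sum:
  assumes p: "p \<in> permutations_of_set {1..k}" and q: "q \<in> permutations_of_set {1..l}"
    and "0 < k" "indecomposable p"
  shows "first_block_index (direct_sum p q) = k"
proof (rule antisym)
  let ?r = "direct_sum p q"
  have len: "length p = k" "set p = {1..k}" using p unfolding permutations_of_set_interval_iff by blast+
  have fp: "first_block_index p = k" using assms(4) len by (simp add: indecomposable_def)
  have pos: "0 < k + l" using \<open>0 < k\<close> by simp
  note r = first_block_index[OF direct_sum_permutation[OF p q] pos]
  show le: "first_block_index ?r \<le> k"
    using \<open>0 < k\<close> by (intro r(3)) (simp_all add: direct_sum_def len)
  then have "take (first_block_index ?r) p = take (first_block_index ?r) ?r" by (simp add: direct_sum_def len)
  then have "first_block_index p \<le> first_block_index ?r"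
    using r(1,2) le by (intro first_block_index(3)[OF p \<open>0 < k\<close>]) auto
  then show "k \<le> first_block_index ?r" using fp by simp
qed

text \<open>\<open>a\<close> is indecomposable by minimality of \<open>k\<close>: a prefix of
  \<open>a\<close> with values \<open>{1..i}\<close> is also one of \<open>p\<close>.\<close>

lemma split_first_block:
  assumes p: "p \<in> permutations_of_set {1..n}" and "0 < n"
  defines "k \<equiv> first_block_index p"
  obtains a b where "a \<in> permutations_of_set {1..k}" "b \<in> permutations_of_set {1..n - k}"
    "indecomposable a" "p = direct_sum a b"
proof -
  note fb = first_block_index[OF assms(1,2), folded k_def]
  have p': "length p = n" "set p = {1..n}" "distinct p" using p unfolding permutations_of_set_interval_iff by blast+
  have k: "0 < k" "k \<le> n" using fb(1) by auto
  define a b where "a = take k p" and "b = map (\<lambda>x. x - k) (drop k p)"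
  have a: "a \<in> permutations_of_set {1..k}" "length a = k"
    unfolding permutations_of_set_interval_iff using fb(2) p' k by (simp_all add: a_def)
  have "set (take k p) \<union> set (drop k p) = {1..n}" using p'(2) by (simp flip: set_append)
  moreover have "set (take k p) \<inter> set (drop k p) = {}"
    using p'(3) by (metis append_take_drop_id distinct_append)
  ultimately have "set (drop k p) = {1..n} - {1..k}" unfolding fb(2) by blast
  moreover have "{1..n} - {1..k} = {k<..n}" using k(1) by auto
  ultimately have drop: "set (drop k p) = {k<..n}" by (simp only:)
  have "(\<lambda>x. x - k) ` {k<..n} = {1..n - k}"
  proof (intro equalityI subsetI)
    fix x assume "x \<in> {1..n - k}"
    then show "x \<in> (\<lambda>x. x - k) ` {k<..n}" by (intro image_eqI[where x = "x + k"]) auto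
  qed auto
  then have "set b = {1..n - k}" using drop by (simp add: b_def)
  moreover have "distinct b" unfolding b_def distinct_map drop using p'(3) by (auto simp: inj_on_def)
  ultimately have b: "b \<in> permutations_of_set {1..n - k}" unfolding permutations_of_set_interval_iff using p'(1) by (simp add: b_def)
  have "map ((+) k) b = drop k p" unfolding b_def map_map using drop by (intro map_idI) auto
  then have "p = direct_sum a b" using a(2) by (simp add: direct_sum_def a_def)
  moreover have "indecomposable a"
  proof -
    note fa = first_block_index[OF a(1) k(1)]
    have "take (first_block_index a) a = take (first_block_index a) p" using fa(1) by (simp add: a_def min_absorb1)
    then have "k \<le> first_block_index a" using fa(1,2) k(2) by (intro fb(3)) auto
    then show ?thesis using fa(1) a(2) by (simp add: indecomposable_def)
  qed
  ultimately show thesis using that a(1) b by blast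
qed

text \<open>The direct sum of an indecomposable avoider of length \<open>k\<close> and any avoider
  has first block index \<open>k\<close>, so the classes \<open>D k\<close> are disjoint, and
  together they exhaust the avoiders.\<close>

lemma card_avoiders_first_block:
  assumes t: "sum_indecomposable t" and "0 < n"
  shows "card (avoiders t n) = (\<Sum>k\<in>{1..n}. card (indecomposables t k) * card (avoiders t (n - k)))"
proof -
  define D where "D k = (\<lambda>(a, b). direct_sum a b) ` (indecomposables t k \<times> avoiders t (n - k))" for k
  have perm: "p \<in> permutations_of_set {1..m}" if "p \<in> avoiders t m" for p m using that by (simp add: avoiders_def)
  have ind: "a \<in> avoiders t k" "indecomposable a" if "a \<in> indecomposables t k" for a k
    using that by (simp_all add: indecomposables_def)
  have avoids: "avoids (direct_sum a b) t \<longleftrightarrow> avoids a t \<and> avoids b t"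
    if "a \<in> permutations_of_set {1..k}" "b \<in> permutations_of_set {1..l}" for a b k l
  proof -
    have "length a = k" "set a = {1..k}" "set b = {1..l}" using that unfolding permutations_of_set_interval_iff by blast+
    then have "\<forall>x\<in>set a. \<forall>y\<in>set (map ((+) (length a)) b). x < y" by auto
    then show ?thesis unfolding direct_sum_def by (simp only: avoids_append_less[OF t] avoids_shift)
  qed
  have fbi: "first_block_index p = k" if "p \<in> D k" "k \<in> {1..n}" for p k
    using that first_block_index_direct_sum[OF perm[OF ind(1)] perm _ ind(2)] by (auto simp: D_def)
  have "avoiders t n = (\<Union>k\<in>{1..n}. D k)"
  proof (intro equalityI subsetI)
    fix p assume p: "p \<in> avoiders t n"
    let ?k = "first_block_index p"
    obtain a b where ab: "a \<in> permutations_of_set {1..?k}" "b \<in> permutations_of_set {1..n - ?k}"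
      "indecomposable a" "p = direct_sum a b" using split_first_block[OF perm[OF p] \<open>0 < n\<close>] by blast
    have "avoids a t" "avoids b t" using p avoids[OF ab(1,2)] ab(4) by (auto simp: avoiders_def)
    then have "(a, b) \<in> indecomposables t ?k \<times> avoiders t (n - ?k)"
      using ab by (simp add: indecomposables_def avoiders_def)
    then have "p \<in> D ?k" unfolding D_def using ab(4) by (intro image_eqI[where x = "(a, b)"]) simp_all
    then show "p \<in> (\<Union>k\<in>{1..n}. D k)" using first_block_index(1)[OF perm[OF p] \<open>0 < n\<close>] by blast
  next
    fix p assume "p \<in> (\<Union>k\<in>{1..n}. D k)"
    then obtain k a b where k: "k \<le> n" "a \<in> indecomposables t k" "b \<in> avoiders t (n - k)" "p = direct_sum a b"
      by (auto simp: D_def)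
    have "p \<in> permutations_of_set {1..k + (n - k)}"
      unfolding k(4) by (rule direct_sum_permutation[OF perm[OF ind(1)[OF k(2)]] perm[OF k(3)]])
    moreover have "avoids p t" unfolding k(4) avoids[OF perm[OF ind(1)[OF k(2)]] perm[OF k(3)]]
      using k(3) ind(1)[OF k(2)] by (simp add: avoiders_def)
    ultimately show "p \<in> avoiders t n" using k(1) by (simp add: avoiders_def)
  qed
  moreover have "card (\<Union>k\<in>{1..n}. D k) = (\<Sum>k\<in>{1..n}. card (D k))"
  proof (rule card_UN_disjoint)
    show "\<forall>k\<in>{1..n}. finite (D k)" by (simp add: D_def indecomposables_def finite_avoiders)
    show "\<forall>i\<in>{1..n}. \<forall>j\<in>{1..n}. i \<noteq> j \<longrightarrow> D i \<inter> D j = {}" using fbi by blast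
  qed simp
  moreover have "card (D k) = card (indecomposables t k) * card (avoiders t (n - k))" for k
  proof -
    have "inj_on (\<lambda>(a, b). direct_sum a b) (indecomposables t k \<times> avoiders t (n - k))"
    proof (rule inj_onI, clarify)
      fix a b a' b'
      assume h: "a \<in> indecomposables t k" "a' \<in> indecomposables t k" "direct_sum a b = direct_sum a' b'"
      have "length a = k" "length a' = k"
        using perm[OF ind(1)[OF h(1)]] perm[OF ind(1)[OF h(2)]] unfolding permutations_of_set_interval_iff by blast+
      then have "a = a'" "map ((+) k) b = map ((+) k) b'" using h(3) by (simp_all add: direct_sum_def)
      then show "a = a' \<and> b = b'" by (simp add: inj_map_eq_map)
    qed
    then show ?thesis unfolding D_def by (simp add: card_image card_cartesian_product)
  qed
  ultimately show ?thesis by simp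
qed

text \<open>The summand \<open>1\<close> is the empty permutation, which has no first block.\<close>

lemma indecomposable_gf_eq:
  assumes t: "sum_indecomposable t" and card: "\<And>n. card (avoiders t n) = length (walk n)"
  shows "S_fps = 1 + indecomposable_gf t * S_fps"
proof (rule fps_ext)
  fix n
  have S: "S_fps $ m = real (card (avoiders t m))" for m
    unfolding walk_gf_1[symmetric] walk_gf_1_nth card ..
  have I: "indecomposable_gf t $ m = real (card (indecomposables t m))" if "0 < m" for m
    using that by (simp add: indecomposable_gf_def num_indecomposable_avoiders_def indecomposables_def avoiders_def)
  have I0: "indecomposable_gf t $ 0 = 0" by (simp add: indecomposable_gf_def)
  show "S_fps $ n = (1 + indecomposable_gf t * S_fps) $ n"
  proof (cases "n = 0")
    case False
    then have "0 < n" by simp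
    have "S_fps $ n = (\<Sum>k\<in>{1..n}. indecomposable_gf t $ k * S_fps $ (n - k))"
      unfolding S card_avoiders_first_block[OF t \<open>0 < n\<close>] by (simp add: I)
    also have "\<dots> = (\<Sum>k\<in>{0..n}. indecomposable_gf t $ k * S_fps $ (n - k))"
      by (simp add: I0 sum.atLeast_Suc_atMost)
    finally show ?thesis using False by (simp add: fps_mult_nth)
  qed (simp add: I0)
qed

section \<open>The six patterns\<close>

lemma sum_indecomposable_quadruple:
  assumes "\<sigma> \<in> {[2,4,3,1], [4,2,1,3], [3,2,4,1], [4,1,3,2], [2,4,1,3], [3,1,4,2]}"
  shows "sum_indecomposable \<sigma>"
  unfolding sum_indecomposable_def
proof (intro allI impI)
  fix k assume "0 < k" "k < length \<sigma>"
  moreover have len: "length \<sigma> = 4" using assms by auto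
  ultimately consider "k = 1" | "k = 2" | "k = 3" by fastforce
  then have "\<exists>i j. i < k \<and> k \<le> j \<and> j < 4 \<and> \<sigma> ! j < \<sigma> ! i"
  proof cases
    case 1
    have "\<exists>j\<in>{1, 2, 3}. \<sigma> ! j < \<sigma> ! 0" using assms by auto
    then obtain j where "j \<in> {1, 2, 3}" "\<sigma> ! j < \<sigma> ! 0" by blast
    then show ?thesis using 1 by (intro exI[of _ 0] exI[of _ j]) auto
  next
    case 2
    have "\<exists>i\<in>{0, 1}. \<exists>j\<in>{2, 3}. \<sigma> ! j < \<sigma> ! i" using assms by auto
    then obtain i j where "i \<in> {0, 1}" "j \<in> {2, 3}" "\<sigma> ! j < \<sigma> ! i" by blast
    then show ?thesis using 2 by (intro exI[of _ i] exI[of _ j]) auto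
  next
    case 3
    have "\<exists>i\<in>{0, 1, 2}. \<sigma> ! 3 < \<sigma> ! i" using assms by auto
    then obtain i where "i \<in> {0, 1, 2}" "\<sigma> ! 3 < \<sigma> ! i" by blast
    then show ?thesis using 3 by (intro exI[of _ i] exI[of _ 3]) auto
  qed
  then show "\<exists>i<k. \<exists>j. k \<le> j \<and> j < length \<sigma> \<and> \<sigma> ! j < \<sigma> ! i"
    unfolding len by blast
qed

text \<open>There are two symmetry classes. 3241 is the reverse complement of 4132, 2431 is the
  inverse of 4132, and 4213 is the reverse complement of 2431. The other class is 3142 with its
  reverse 2413.\<close>

lemma card_avoiders_quadruple:
  assumes "\<sigma> \<in> {[2,4,3,1], [4,2,1,3], [3,2,4,1], [4,1,3,2], [2,4,1,3], [3,1,4,2]}"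
  shows "card (avoiders \<sigma> n) = length (walk n)"
proof -
  have rc: "card (avoiders (complement 4 (rev t)) n) = card (avoiders t n)" if "set t \<subseteq> {1..4}" for t
    using that card_avoiders_complement[of "rev t" 4] card_avoiders_rev by simp
  have c4132: "card (avoiders [4,1,3,2] n) = length (walk n)"
    unfolding avoiders_def avoids_4132 by (rule card_no_4132)
  have c3142: "card (avoiders [3,1,4,2] n) = length (walk n)"
    unfolding avoiders_def avoids_3142 by (rule card_no_3142)
  have "card (avoiders [3,2,4,1] n) = length (walk n)"
    using rc[of "[4,1,3,2]"] c4132 by (simp add: complement_def)
  moreover have "card (avoiders [2,4,1,3] n) = length (walk n)"
    using card_avoiders_rev[of "[3,1,4,2]"] c3142 by simp
  moreover have p: "[2,4,3,1] \<in> permutations_of_set {1..4::nat}"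
    by (auto simp: permutations_of_set_def)
  have "inverse_word [2,4,3,1] = [4,1,3,2]"
  proof (rule nth_equalityI)
    note iw = inverse_word[OF p]
    show "length (inverse_word [2,4,3,1]) = length [4,1,3,2::nat]" using iw(2) by simp
    fix i assume "i < length (inverse_word [2,4,3,1])"
    then have "i = 0 \<or> i = 1 \<or> i = 2 \<or> i = 3" using iw(2) by auto
    then show "inverse_word [2,4,3,1] ! i = [4,1,3,2] ! i"
      using iw(3)[of 0] iw(3)[of 1] iw(3)[of 2] iw(3)[of 3] by auto
  qed
  then have c2431: "card (avoiders [2,4,3,1] n) = length (walk n)"
    using card_avoiders_inverse[OF p, of n] c4132 by simp
  moreover have "card (avoiders [4,2,1,3] n) = length (walk n)"
    using rc[of "[2,4,3,1]"] c2431 by (simp add: complement_def)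
  ultimately show ?thesis using assms c4132 c3142 c2431 by auto
qed

theorem theorem3p3:
  fixes \<sigma> :: "nat list"
  assumes "\<sigma> \<in> {[2,4,3,1], [4,2,1,3], [3,2,4,1], [4,1,3,2], [2,4,1,3], [3,1,4,2]}"
  shows "indecomposable_gf \<sigma> =
    (- 1 + 12 * fps_X + 8 * fps_X ^ 2 + (fps_binomial (3 / 2) oo (- 8 * fps_X))) / (32 * fps_X)"
  by (intro S_fps_closed_form indecomposable_gf_eq sum_indecomposable_quadruple[OF assms]
      card_avoiders_quadruple[OF assms])

end
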